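(* Let $p\ge 3$ and $q\ge 2$. The subcomplex $\Sigma_{p,2q}$ of the wedge product $\mathcal{W}_{p,q-1}=C_p\triangleleft\Delta_{q-1}$ of a $p$-gon and a $(q-1)$-simplex is a closed connected orientable regular $2$-manifold of type $\{p,2q\}$, with $f$-vector $$f(\Sigma_{p,2q})=(f_0,f_1,f_2)=(p,\;pq,\;2q)\,q^{p-2}$$ and genus $1+\tfrac12 q^{p-2}(pq-p-2q)$.
   Context: Notation: $[n]=\{0,1,\dots,n-1\}$. Let $C_p=\{x\in\mathbb{R}^2 : a_ix\le1,\ i\in[p]\}$ be a convex $p$-gon with its $p$ edges labeled in cyclic order, and $\Delta_{q-1}=\{y\in\mathbb{R}^{q-1} : b_jy\le1,\ j\in[q]\}$ a $(q-1)$-simplex (both given by their facet inequalities). The wedge product is the polytope $$\mathcal{W}_{p,q-1}=C_p\triangleleft\Delta_{q-1}=\{(x,y_0,\dots,y_{p-1})\in\mathbb{R}^{2+p(q-1)} : a_ix+b_jy_i\le1\ \text{for all } i\in[p],\ j\in[q]\}.$$ It has dimension $2+p(q-1)$ and $pq$ facets, with facet hyperplanes $h_{i,j}: a_ix+b_jy_i=1$. A face $G$ is denoted by the vector $(H_0,\dots,H_{p-1})$, $H_i\subseteq[q]$, where $j\in H_i\iff G\subset h_{i,j}$. For $j\in[q]$ write $\overline{j}=[q]\setminus\{j\}$. All vectors $(\overline{j_0},\dots,\overline{j_{p-1}})$ with $j_k\in[q]$ denote faces that are $p$-gons. $\Sigma_{p,2q}$ is the polytopal subcomplex of the boundary of $\mathcal{W}_{p,q-1}$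 consisting of the $p$-gon faces $(\overline{j_0},\dots,\overline{j_{p-1}})$ with $\sum_{k=0}^{p-1}j_k\equiv 0$ or $1 \pmod q$, together with all their edges and vertices. Type $\{p,2q\}$ means: all $2$-faces are $p$-gons and every vertex has degree $2q$. Regular means: the combinatorial automorphism group (automorphisms of the face poset) acts transitively on flags (vertex $\subset$ edge $\subset$ polygon). $f_i$ is the number of $i$-dimensional faces. *)

theory Defs
  imports "HOL-Analysis.Analysis" "HOL-Number_Theory.Cong"
begin

section \<open>Polytopes given by facet inequalities\<close>

definition ineq_polyhedron :: "nat \<Rightarrow> (nat \<Rightarrow> 'a::euclidean_space) \<Rightarrow> 'a set" where
  "ineq_polyhedron n c = {x. \<forall>i<n. c i \<bullet> x \<le> 1}"

definition ineq_face :: "nat \<Rightarrow> (nat \<Rightarrow> 'a::euclidean_space) \<Rightarrow> nat \<Rightarrow> 'a set" where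
  "ineq_face n c i = {x \<in> ineq_polyhedron n c. c i \<bullet> x = 1}"

definition facet_inequalities :: "nat \<Rightarrow> (nat \<Rightarrow> 'a::euclidean_space) \<Rightarrow> bool" where
  "facet_inequalities n c \<longleftrightarrow>
     bij_betw (ineq_face n c) {..<n} {F. F facet_of ineq_polyhedron n c}"

definition convex_polygon :: "nat \<Rightarrow> 'a::euclidean_space set \<Rightarrow> bool" where
  "convex_polygon n P \<longleftrightarrow>
     polytope P \<and> aff_dim P = 2 \<and> card {v. v extreme_point_of P} = n"

text \<open>Distinct edges of a convex polygon meet iff they are adjacent, so the last conjunct
  says that the edges are labelled in cyclic order.\<close>

definition polygon_presentation :: "nat \<Rightarrow> (nat \<Rightarrow> real^2) \<Rightarrow> bool" where
  "polygon_presentation p a \<longleftrightarrow>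
     convex_polygon p (ineq_polyhedron p a) \<and> facet_inequalities p a \<and>
     (\<forall>i<p. ineq_face p a i \<inter> ineq_face p a (Suc i mod p) \<noteq> {})"

definition simplex_presentation :: "nat \<Rightarrow> (nat \<Rightarrow> 'a::euclidean_space) \<Rightarrow> bool" where
  "simplex_presentation q b \<longleftrightarrow>
     (int q - 1) simplex (ineq_polyhedron q b) \<and> facet_inequalities q b"


section \<open>The wedge product and its distinguished subcomplex\<close>

text \<open>The ambient space is realised as \<open>(real^2) \<times> (real^'r^'p)\<close> where \<open>CARD('p) = p\<close> and
  \<open>CARD('r) = q - 1\<close>; its dimension is \<open>2 + p (q - 1)\<close>. The map \<open>\<iota>\<close> is a bijection from
  \<open>{..<p}\<close> to \<open>'p\<close> numbering the blocks, so that \<open>y\<^sub>i\<close> is \<open>snd z $ \<iota> i\<close> for \<open>z = (x, y)\<close>.\<close>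

definition wedge_product ::
  "nat \<Rightarrow> nat \<Rightarrow> (nat \<Rightarrow> real^2) \<Rightarrow> (nat \<Rightarrow> real^'r) \<Rightarrow> (nat \<Rightarrow> 'p) \<Rightarrow> ((real^2) \<times> (real^'r^'p)) set" where
  "wedge_product p q a b \<iota> =
     {z. \<forall>i<p. \<forall>j<q. a i \<bullet> fst z + b j \<bullet> (snd z $ \<iota> i) \<le> 1}"

definition facet_hyperplane ::
  "(nat \<Rightarrow> real^2) \<Rightarrow> (nat \<Rightarrow> real^'r) \<Rightarrow> (nat \<Rightarrow> 'p) \<Rightarrow> nat \<Rightarrow> nat \<Rightarrow> ((real^2) \<times> (real^'r^'p)) set" where
  "facet_hyperplane a b \<iota> i j = {z. a i \<bullet> fst z + b j \<bullet> (snd z $ \<iota> i) = 1}"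

text \<open>The \<open>i\<close>-th entry \<open>H\<^sub>i\<close> of the vector denoting the face \<open>G\<close>.\<close>

definition face_entry ::
  "nat \<Rightarrow> (nat \<Rightarrow> real^2) \<Rightarrow> (nat \<Rightarrow> real^'r) \<Rightarrow> (nat \<Rightarrow> 'p) \<Rightarrow> ((real^2) \<times> (real^'r^'p)) set \<Rightarrow> nat \<Rightarrow> nat set"
  where
  "face_entry q a b \<iota> G i = {j\<in>{..<q}. G \<subseteq> facet_hyperplane a b \<iota> i j}"

definition Sigma_polygons ::
  "nat \<Rightarrow> nat \<Rightarrow> (nat \<Rightarrow> real^2) \<Rightarrow> (nat \<Rightarrow> real^'r) \<Rightarrow> (nat \<Rightarrow> 'p) \<Rightarrow> ((real^2) \<times> (real^'r^'p)) set set" where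
  "Sigma_polygons p q a b \<iota> =
     {G. G face_of wedge_product p q a b \<iota> \<and>
         (\<exists>j. (\<forall>k<p. j k < q \<and> face_entry q a b \<iota> G k = {..<q} - {j k}) \<and>
              ([(\<Sum>k<p. j k) = 0] (mod q) \<or> [(\<Sum>k<p. j k) = 1] (mod q)))}"

text \<open>The polygons with their edges and vertices, i.e. all nonempty faces of the polygons.
  The empty face is not a member of the complex.\<close>

definition Sigma_complex ::
  "nat \<Rightarrow> nat \<Rightarrow> (nat \<Rightarrow> real^2) \<Rightarrow> (nat \<Rightarrow> real^'r) \<Rightarrow> (nat \<Rightarrow> 'p) \<Rightarrow> ((real^2) \<times> (real^'r^'p)) set set" where
  "Sigma_complex p q a b \<iota> =
     {F. F \<noteq> {} \<and> (\<exists>G\<in>Sigma_polygons p q a b \<iota>. F face_of G)}"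


section \<open>Polyhedral surfaces\<close>

text \<open>In this section a polytopal complex is the set of its nonempty faces, and its underlying
  space is the union of these.\<close>

definition closed_2_manifold :: "'a::euclidean_space set \<Rightarrow> bool" where
  "closed_2_manifold M \<longleftrightarrow>
     compact M \<and>
     (\<forall>x\<in>M. \<exists>U. \<exists>V::(real^2) set.
        openin (top_of_set M) U \<and> x \<in> U \<and> open V \<and> U homeomorphic V)"

definition cells :: "nat \<Rightarrow> 'a::euclidean_space set set \<Rightarrow> 'a set set" where
  "cells d K = {F \<in> K. aff_dim F = int d}"

definition f_number :: "nat \<Rightarrow> 'a::euclidean_space set set \<Rightarrow> nat" where
  "f_number d K = card (cells d K)"

text \<open>An orientation of a polygon is one of the two directed cycles running around its boundary,
  encoded by the set of ordered pairs (tail, head) of its directed edges.\<close>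

definition polygon_orientation :: "'a::euclidean_space set \<Rightarrow> ('a \<times> 'a) set \<Rightarrow> bool" where
  "polygon_orientation P D \<longleftrightarrow>
     (\<exists>n c. n \<ge> 3 \<and> bij_betw c {..<n} {v. v extreme_point_of P} \<and>
        (\<forall>i<n. closed_segment (c i) (c (Suc i mod n)) edge_of P) \<and>
        D = (\<lambda>i. (c i, c (Suc i mod n))) ` {..<n})"

text \<open>The polygons can be oriented such that polygons with a common edge induce
  opposite directions on it, i.e. no directed edge occurs in two polygons.\<close>

definition orientable :: "'a::euclidean_space set set \<Rightarrow> bool" where
  "orientable K \<longleftrightarrow>
     (\<exists>D. (\<forall>P\<in>cells 2 K. polygon_orientation P (D P)) \<and>
          (\<forall>P\<in>cells 2 K. \<forall>Q\<in>cells 2 K. P \<noteq> Q \<longrightarrow> D P \<inter> D Q = {}))"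

definition complex_automorphism :: "'a set set \<Rightarrow> ('a set \<Rightarrow> 'a set) \<Rightarrow> bool" where
  "complex_automorphism K \<phi> \<longleftrightarrow>
     bij_betw \<phi> K K \<and> (\<forall>F\<in>K. \<forall>G\<in>K. \<phi> F \<subseteq> \<phi> G \<longleftrightarrow> F \<subseteq> G)"

definition flag :: "'a::euclidean_space set set \<Rightarrow> 'a set \<Rightarrow> 'a set \<Rightarrow> 'a set \<Rightarrow> bool" where
  "flag K v e P \<longleftrightarrow> v \<in> cells 0 K \<and> e \<in> cells 1 K \<and> P \<in> cells 2 K \<and> v \<subseteq> e \<and> e \<subseteq> P"

definition regular_complex :: "'a::euclidean_space set set \<Rightarrow> bool" where
  "regular_complex K \<longleftrightarrow>
     (\<forall>v e P v' e' P'. flag K v e P \<and> flag K v' e' P' \<longrightarrow>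
        (\<exists>\<phi>. complex_automorphism K \<phi> \<and> \<phi> v = v' \<and> \<phi> e = e' \<and> \<phi> P = P'))"

definition has_type :: "'a::euclidean_space set set \<Rightarrow> nat \<Rightarrow> nat \<Rightarrow> bool" where
  "has_type K m d \<longleftrightarrow>
     (\<forall>P\<in>cells 2 K. convex_polygon m P) \<and>
     (\<forall>v\<in>cells 0 K. card {e\<in>cells 1 K. v \<subseteq> e} = d)"

definition euler_characteristic :: "'a::euclidean_space set set \<Rightarrow> int" where
  "euler_characteristic K = int (f_number 0 K) - int (f_number 1 K) + int (f_number 2 K)"

text \<open>The genus of a closed connected orientable polyhedral surface is the natural number \<open>g\<close>
  such that the Euler characteristic is \<open>2 - 2 g\<close>.\<close>

definition has_genus :: "'a::euclidean_space set set \<Rightarrow> nat \<Rightarrow> bool" where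
  "has_genus K g \<longleftrightarrow>
     closed_2_manifold (\<Union>K) \<and> connected (\<Union>K) \<and> orientable K \<and>
     euler_characteristic K = 2 - 2 * int g"

end

(*
  Let t_k(x) = 1 - a_k x be the slack of the k-th edge inequality of C_p, and let w_0, ..., w_(q-1)
  be the vertices of the simplex, w_j being opposite to the facet j. The polygon with vector
  (j_0, ..., j_(p-1)) is the graph over C_p of the affine map x |-> (t_k(x) w_(j_k))_k, and two
  such graphs agree over x iff their j_k agree for all k with t_k(x) \<noteq> 0. So the surface
  consists of 2 q^(p-1) copies of C_p, two of which share the edge k iff their vectors differ at
  most at k. As the sum of the j_k is 0 or 1 modulo q, each edge lies in exactly two polygons, one
  of either sum (hence orientability), and the polygons around a vertex form a cycle of length 2q,
  which the chart at the vertex sends to the cones of a fan of 2q rays. Dihedral permutations of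
  the indices k together with the maps j_k |-> c_k + j_k and j_k |-> c_k - j_k that preserve the
  condition on the sum act transitively on flags.
*)
theory Submission
  imports Defs
begin

section \<open>Planar convex polygons\<close>

text \<open>The polygon is known only through its inequalities and the fact that consecutive edges
  meet, so which edges pass through which points has to be derived; afterwards \<open>C\<close> is
  seen mainly through the sets of indices at which slacks vanish. A face of the surface is then a
  vector together with such a set, the entries inside the set being forgotten. A forgotten entry can
  always be chosen so that the sum gets the residue 0, so the sum condition restricts polygons but
  neither edges nor vertices; the counts, the degrees and connectedness rest on this. No symmetry of
  \<open>C\<close> itself is available, so automorphisms are defined on labels of faces. The
  obstacle in the chart is continuity in both directions across many polygons. Instead of gluing
  closed pieces, each direction is one formula, a sum over all q digits of coefficient functions:
  barycentric coordinates in the simplex on one side, hat functions of the fan on the other. On each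
  polygon only its own digit survives.\<close>

lemma parallel_imp_orthogonal:
  fixes x y d :: "real^2"
  assumes "x $ 1 * y $ 2 = x $ 2 * y $ 1" "x \<bullet> d = 0" "x \<noteq> 0"
  shows "y \<bullet> d = 0"
proof -
  have "x $ 1 * (y \<bullet> d) = y $ 1 * (x \<bullet> d)" "x $ 2 * (y \<bullet> d) = y $ 2 * (x \<bullet> d)"
    using assms(1) by (auto simp: inner_vec_def sum_2 algebra_simps)
  then show ?thesis
    using assms(2,3) by (auto simp: vec_eq_iff forall_2)
qed

text \<open>Three plane vectors satisfy a linear relation, here with 2-by-2 minors as coefficients.
  Evaluating it at \<open>d\<close>, \<open>e\<close> and \<open>f\<close> drops one term each and
  gives the coefficients pairwise opposite signs, which is impossible. This excludes three edges
  through one point.\<close>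

lemma three_half_planes:
  fixes x y z d e f :: "real^2"
  assumes "x \<bullet> d = 0" "y \<bullet> d < 0" "z \<bullet> d < 0"
    and "x \<bullet> e < 0" "y \<bullet> e = 0" "z \<bullet> e < 0"
    and "x \<bullet> f < 0" "y \<bullet> f < 0" "z \<bullet> f = 0"
  shows False
proof -
  define l m n where "l = y $ 1 * z $ 2 - y $ 2 * z $ 1"
    and "m = z $ 1 * x $ 2 - z $ 2 * x $ 1" and "n = x $ 1 * y $ 2 - x $ 2 * y $ 1"
  have dep: "l * (x \<bullet> v) + m * (y \<bullet> v) + n * (z \<bullet> v) = 0" for v
    by (simp add: l_def m_def n_def inner_vec_def sum_2 algebra_simps)
  have "x \<noteq> 0" using assms(4) by auto
  then have n: "n \<noteq> 0"
    using parallel_imp_orthogonal[of x y d] assms by (auto simp: n_def)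
  have opp: "s * t < 0" if "s * u + t * w = 0" "t \<noteq> 0" "u < 0" "w < 0" for s t u w :: real
  proof -
    have "s * t * u = - (t * t * w)"
      using arg_cong[OF that(1), of "(*) t"] by (simp add: algebra_simps)
    also have "\<dots> > 0" using that by (auto simp: mult_less_0_iff zero_less_mult_iff)
    finally show ?thesis using that(3) by (simp add: zero_less_mult_iff)
  qed
  have mn: "m * n < 0" using opp[of m "y \<bullet> d" n "z \<bullet> d"] dep[of d] assms n by simp
  have ln: "l * n < 0" using opp[of l "x \<bullet> e" n "z \<bullet> e"] dep[of e] assms n by simp
  have "l * m < 0" using opp[of l "x \<bullet> f" m "y \<bullet> f"] dep[of f] assms mn by (cases "m = 0") auto
  with mn ln show False by (auto simp: mult_less_0_iff)
qed

locale cyclic_polygon =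
  fixes p :: nat and a :: "nat \<Rightarrow> real^2"
  assumes p3: "p \<ge> 3" and presentation: "polygon_presentation p a"
begin

abbreviation C where "C \<equiv> ineq_polyhedron p a"
abbreviation E where "E \<equiv> ineq_face p a"

definition slack :: "nat \<Rightarrow> real^2 \<Rightarrow> real" where "slack k x = 1 - a k \<bullet> x"

definition nxt :: "nat \<Rightarrow> nat" where "nxt i = Suc i mod p"

text \<open>The possible sets of edges through a point of \<open>C\<close>: none in the interior,
  one inside an edge, two cyclically consecutive ones at a vertex. They index the nonempty faces of
  \<open>C\<close>, in reverse order of inclusion.\<close>

definition admissible :: "nat set \<Rightarrow> bool" where
  "admissible N \<longleftrightarrow> N = {} \<or> (\<exists>i<p. N = {i} \<or> N = {i, nxt i})"

definition polygon_face :: "nat set \<Rightarrow> (real^2) set" where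
  "polygon_face N = {x \<in> C. \<forall>k\<in>N. slack k x = 0}"

lemma nxt_less [simp]: "nxt i < p" and nxt_neq [simp]: "i < p \<Longrightarrow> nxt i \<noteq> i" "i < p \<Longrightarrow> i \<noteq> nxt i"
  and nxt_nxt_neq [simp]: "i < p \<Longrightarrow> nxt (nxt i) \<noteq> i" "i < p \<Longrightarrow> i \<noteq> nxt (nxt i)"
proof -
  show less: "nxt i < p" for i using p3 by (simp add: nxt_def)
  have nxt: "nxt i = (if Suc i = p then 0 else Suc i)" if "i < p" for i
    using that by (auto simp: nxt_def)
  show "i < p \<Longrightarrow> nxt i \<noteq> i" "i < p \<Longrightarrow> i \<noteq> nxt i"
    "i < p \<Longrightarrow> nxt (nxt i) \<noteq> i" "i < p \<Longrightarrow> i \<noteq> nxt (nxt i)"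
    using p3 less[of i] by (auto simp: nxt split: if_splits)
qed

lemma ex_nxt: "m < p \<Longrightarrow> \<exists>i<p. m = nxt i"
  using p3 by (intro exI[of _ "if m = 0 then p - 1 else m - 1"]) (auto simp: nxt_def mod_Suc)

lemma C_iff: "x \<in> C \<longleftrightarrow> (\<forall>k<p. 0 \<le> slack k x)"
  by (auto simp: ineq_polyhedron_def slack_def)

lemma E_iff: "x \<in> E i \<longleftrightarrow> x \<in> C \<and> slack i x = 0"
  by (auto simp: ineq_face_def slack_def)

lemma slack_nonneg: "x \<in> C \<Longrightarrow> k < p \<Longrightarrow> 0 \<le> slack k x"
  by (simp add: C_iff)

lemma slack_affine: "slack k ((1 - u) *\<^sub>R x + u *\<^sub>R y) = (1 - u) * slack k x + u * slack k y"
  by (simp add: slack_def inner_add_right algebra_simps)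

lemma polytope_C: "polytope C" and aff_dim_C: "aff_dim C = 2"
  and card_vertices: "card {v. v extreme_point_of C} = p"
  using presentation by (auto simp: polygon_presentation_def convex_polygon_def)

lemma convex_C: "convex C"
  using polytope_C by (rule polytope_imp_convex)

lemma edges_bij: "bij_betw E {..<p} {F. F facet_of C}"
  using presentation by (auto simp: polygon_presentation_def facet_inequalities_def)

lemma E_facet: "i < p \<Longrightarrow> E i facet_of C"
  using bij_betwE[OF edges_bij] by auto

lemma E_face: "i < p \<Longrightarrow> E i face_of C" and aff_dim_E: "i < p \<Longrightarrow> aff_dim (E i) = 1"
  using E_facet[of i] aff_dim_C by (auto simp: facet_of_def)

text \<open>An edge contained in a different edge would be a proper face of it, hence of smaller
  dimension, while all edges have dimension 1. That the two edges differ comes from the injectivity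
  of the labelling.\<close>

lemma E_not_subset:
  assumes "i < p" "j < p" "i \<noteq> j"
  obtains x where "x \<in> E i" "slack j x > 0"
proof -
  have "\<not> E i \<subseteq> E j"
  proof
    assume sub: "E i \<subseteq> E j"
    have "E i face_of E j"
      by (rule face_of_subset[OF E_face[OF assms(1)] sub face_of_imp_subset[OF E_face[OF assms(2)]]])
    moreover have "E i \<noteq> E j"
      using edges_bij assms by (auto simp: bij_betw_def inj_on_def)
    ultimately have "aff_dim (E i) < aff_dim (E j)"
      using face_of_aff_dim_lt face_of_imp_convex[OF E_face[OF assms(2)]] by blast
    then show False using aff_dim_E assms by simp
  qed
  then obtain x where "x \<in> E i" "x \<notin> E j" by auto
  then show ?thesis
    using that[of x] slack_nonneg[of x j] assms by (auto simp: E_iff less_le)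
qed

lemma at_most_two_edges:
  assumes "i < p" "j < p" "k < p" "i \<noteq> j" "i \<noteq> k" "j \<noteq> k"
    and "x \<in> C" "slack i x = 0" "slack j x = 0" "slack k x = 0"
  shows False
proof -
  have dir: "\<exists>d. a i \<bullet> d = 0 \<and> a j \<bullet> d < 0 \<and> a k \<bullet> d < 0"
    if lt: "i < p" "j < p" "k < p" "i \<noteq> j" "i \<noteq> k" and x: "slack i x = 0" "slack j x = 0" "slack k x = 0" for i j k
  proof -
    obtain y where y: "y \<in> E i" "slack j y > 0" using E_not_subset lt by metis
    obtain z where z: "z \<in> E i" "slack k z > 0" using E_not_subset lt by metis
    have "slack k y \<ge> 0" "slack j z \<ge> 0" using y z lt slack_nonneg by (auto simp: E_iff)
    moreover have "a m \<bullet> ((y - x) + (z - x)) = a m \<bullet> y + a m \<bullet> z - 2 * (a m \<bullet> x)" for m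
      unfolding inner_add_right inner_diff_right by simp
    ultimately show ?thesis
      \<comment> \<open>Both summands run along edge \<open>i\<close>; the first leaves edge
        \<open>j\<close>, the second leaves edge \<open>k\<close>, and neither points out of
        \<open>C\<close>, so the sum leaves both.\<close>
      using y z x by (intro exI[of _ "(y - x) + (z - x)"]) (auto simp: E_iff slack_def)
  qed
  obtain d where d: "a i \<bullet> d = 0" "a j \<bullet> d < 0" "a k \<bullet> d < 0"
    using dir[of i j k] assms by blast
  obtain e where e: "a j \<bullet> e = 0" "a i \<bullet> e < 0" "a k \<bullet> e < 0"
    using dir[of j i k] assms by blast
  obtain f where f: "a k \<bullet> f = 0" "a i \<bullet> f < 0" "a j \<bullet> f < 0"
    using dir[of k i j] assms by blast
  show False by (rule three_half_planes[OF d e(2,1,3) f(2,3,1)])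
qed

lemma E_Int_singleton:
  assumes "i < p" "j < p" "i \<noteq> j" "x \<in> E i" "x \<in> E j"
  shows "E i \<inter> E j = {x}" "x extreme_point_of C"
proof -
  have face: "E i \<inter> E j face_of C"
    using assms E_face face_of_Int by blast
  have sub: "E i \<inter> E j face_of E i"
    by (rule face_of_subset[OF face]) (use face_of_imp_subset[OF E_face[OF assms(1)]] in auto)
  have "E i \<inter> E j \<noteq> E i"
    using E_not_subset[OF assms(1-3)] by (metis E_iff IntE less_irrefl)
  then have "aff_dim (E i \<inter> E j) < 1"
    using face_of_aff_dim_lt[OF face_of_imp_convex[OF E_face[OF assms(1)]] sub] aff_dim_E assms
    by simp
  moreover have "aff_dim (E i \<inter> E j) \<noteq> -1"
    using assms aff_dim_empty[of "E i \<inter> E j"] by auto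
  moreover have "aff_dim (E i \<inter> E j) \<ge> -1" by (rule aff_dim_geq)
  ultimately have "aff_dim (E i \<inter> E j) = 0" by linarith
  then obtain y where "E i \<inter> E j = {y}" by (auto simp: aff_dim_eq_0)
  moreover have "x \<in> E i \<inter> E j" using assms by auto
  ultimately show "E i \<inter> E j = {x}" by (metis singletonD)
  with face show "x extreme_point_of C" by (simp add: face_of_singleton)
qed

section \<open>Vertices and the face lattice of the polygon\<close>

definition vert :: "nat \<Rightarrow> real^2" where "vert i = (SOME x. x \<in> E i \<inter> E (nxt i))"

lemma vert_mem: assumes "i < p" shows "vert i \<in> E i" "vert i \<in> E (nxt i)"
proof -
  have "E i \<inter> E (nxt i) \<noteq> {}"
    using presentation assms by (auto simp: polygon_presentation_def nxt_def)
  then have "vert i \<in> E i \<inter> E (nxt i)"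
    unfolding vert_def by (rule some_in_eq[THEN iffD2])
  then show "vert i \<in> E i" "vert i \<in> E (nxt i)" by auto
qed

lemma vert_C: "i < p \<Longrightarrow> vert i \<in> C"
  using vert_mem by (auto simp: E_iff)

lemma E_Int_nxt: "i < p \<Longrightarrow> E i \<inter> E (nxt i) = {vert i}"
  and vert_extreme: "i < p \<Longrightarrow> vert i extreme_point_of C"
  using E_Int_singleton[of i "nxt i" "vert i"] vert_mem by auto

lemma slack_vert: assumes "i < p" "k < p" shows "slack k (vert i) = 0 \<longleftrightarrow> k = i \<or> k = nxt i"
  using at_most_two_edges[of i "nxt i" k "vert i"] vert_mem[OF assms(1)] assms by (auto simp: E_iff)

lemma vert_inj: assumes "i < p" "j < p" "vert i = vert j" shows "i = j"
proof (rule ccontr)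
  assume ne: "i \<noteq> j"
  then have "j = nxt i" using slack_vert[of i j] slack_vert[of j j] assms by auto
  moreover have "nxt j = i \<or> nxt j = nxt i"
    using slack_vert[of i "nxt j"] slack_vert[of j "nxt j"] assms by auto
  ultimately show False using assms by (metis nxt_nxt_neq(1) nxt_neq(1))
qed

text \<open>The corners \<open>vert i\<close> are \<open>p\<close> distinct extreme points, and the
  polygon is assumed to have exactly \<open>p\<close> of them.\<close>

lemma vertices: "{x. x extreme_point_of C} = vert ` {..<p}"
proof (rule card_subset_eq[symmetric])
  show "finite {x. x extreme_point_of C}"
    by (rule card_ge_0_finite) (use card_vertices p3 in auto)
  show "card (vert ` {..<p}) = card {x. x extreme_point_of C}"
    using vert_inj by (subst card_image) (auto simp: inj_on_def card_vertices)
qed (use vert_extreme in auto)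

text \<open>The edge is some segment; extreme points of \<open>C\<close> lying in it can only be its
  ends, and \<open>vert i\<close> and \<open>vert (nxt i)\<close> are two distinct such points. Note
  the shift: the edge between them has index \<open>nxt i\<close>.\<close>

lemma E_nxt: assumes "i < p" shows "E (nxt i) = closed_segment (vert i) (vert (nxt i))"
proof -
  have face: "E (nxt i) face_of C" by (simp add: E_face)
  have poly: "polytope (E (nxt i))"
    by (rule face_of_polytope_polytope[OF polytope_C face])
  obtain c d where cd: "E (nxt i) = closed_segment c d"
    by (rule compact_convex_collinear_segment[of "E (nxt i)"])
      (use poly vert_mem assms aff_dim_E[of "nxt i"] in
        \<open>auto simp: polytope_imp_compact polytope_imp_convex collinear_aff_dim\<close>)
  have "x = c \<or> x = d" if "x extreme_point_of C" "x \<in> E (nxt i)" for x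
    using extreme_point_of_face[OF face, of x] that unfolding cd by (simp add: extreme_point_of_segment)
  then have "vert i = c \<or> vert i = d" "vert (nxt i) = c \<or> vert (nxt i) = d"
    using vert_extreme vert_mem assms by auto
  moreover have "vert i \<noteq> vert (nxt i)"
    using vert_inj[of i "nxt i"] assms by auto
  ultimately show ?thesis using cd closed_segment_commute by metis
qed

lemma two_zeros:
  assumes "x \<in> C" "i < p" "j < p" "i \<noteq> j" "slack i x = 0" "slack j x = 0"
  obtains m where "m < p" "x = vert m"
proof -
  have "x extreme_point_of C"
    using E_Int_singleton[of i j x] assms by (auto simp: E_iff)
  then show ?thesis using vertices that by auto
qed

lemma admissible_zeros:
  assumes "x \<in> C"
  shows "admissible {k. k < p \<and> slack k x = 0}" (is "admissible ?Z")
proof -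
  consider "?Z = {}" | i where "?Z = {i}" | i j where "i \<in> ?Z" "j \<in> ?Z" "i \<noteq> j"
    by (metis (no_types, lifting) ex_in_conv insertI1 subsetI subset_singletonD singletonD)
  then show ?thesis
  proof cases
    case (3 i j)
    then obtain m where m: "m < p" "x = vert m" using two_zeros[of x i j] assms by auto
    then have "?Z = {m, nxt m}" using slack_vert by auto
    then show ?thesis using m(1) by (auto simp: admissible_def)
  qed (auto simp: admissible_def)
qed

lemma polygon_face_simps: "polygon_face {} = C" "polygon_face {i} = E i" "i < p \<Longrightarrow> polygon_face {i, nxt i} = {vert i}"
  using E_Int_nxt[of i] by (auto simp: polygon_face_def E_iff set_eq_iff)

lemma admissible_cases [consumes 1, case_names empty edge vertex]:
  assumes "admissible N"
  obtains "N = {}" | i where "i < p" "N = {i}" | i where "i < p" "N = {i, nxt i}"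
  using assms by (auto simp: admissible_def)

text \<open>By dimension: a proper nonempty face is either a point, hence an extreme point, or of
  dimension 1, hence a facet and so one of the labelled edges.\<close>

lemma face_of_C_iff: "F face_of C \<and> F \<noteq> {} \<longleftrightarrow> (\<exists>N. admissible N \<and> F = polygon_face N)"
proof
  assume F: "F face_of C \<and> F \<noteq> {}"
  show "\<exists>N. admissible N \<and> F = polygon_face N"
  proof (cases "F = C")
    case True
    then show ?thesis by (intro exI[of _ "{}"]) (auto simp: admissible_def polygon_face_simps)
  next
    case False
    then have "aff_dim F < 2"
      using face_of_aff_dim_lt[of C F] convex_C F aff_dim_C by auto
    moreover have "aff_dim F \<noteq> -1" "aff_dim F \<ge> -1"
      using F aff_dim_empty[of F] by (auto simp: aff_dim_geq)
    ultimately consider "aff_dim F = 0" | "aff_dim F = 1" by linarith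
    then show ?thesis
    proof cases
      case 1
      then obtain x where "F = {x}" by (auto simp: aff_dim_eq_0)
      then have "x extreme_point_of C" using F by (auto simp: face_of_singleton)
      then obtain i where "i < p" "x = vert i" using vertices by auto
      then show ?thesis using \<open>F = {x}\<close>
        by (intro exI[of _ "{i, nxt i}"]) (auto simp: admissible_def polygon_face_simps)
    next
      case 2
      then have "F facet_of C" using F aff_dim_C by (auto simp: facet_of_def)
      then obtain i where "i < p" "F = E i"
        using edges_bij by (auto simp: bij_betw_def set_eq_iff image_iff)
      then show ?thesis
        by (intro exI[of _ "{i}"]) (auto simp: admissible_def polygon_face_simps)
    qed
  qed
next
  assume "\<exists>N. admissible N \<and> F = polygon_face N"
  then obtain N where N: "admissible N" "F = polygon_face N" by auto
  from N(1) show "F face_of C \<and> F \<noteq> {}"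
  proof (cases rule: admissible_cases)
    case empty
    then show ?thesis using N face_of_refl[OF convex_C] vert_C[of 0] p3 by (auto simp: polygon_face_simps)
  next
    case (edge i)
    then show ?thesis using N E_face vert_mem by (auto simp: polygon_face_simps)
  next
    case (vertex i)
    then show ?thesis using N vert_extreme by (auto simp: polygon_face_simps face_of_singleton)
  qed
qed

lemma admissible_subset: "admissible N \<Longrightarrow> N \<subseteq> {..<p}"
  by (auto simp: admissible_def)

lemma admissible_finite: "admissible N \<Longrightarrow> finite N"
  by (auto simp: admissible_def)

lemma aff_dim_polygon_face: assumes "admissible N" shows "aff_dim (polygon_face N) = 2 - int (card N)"
  using assms by (cases rule: admissible_cases) (auto simp: polygon_face_simps aff_dim_C aff_dim_E)

text \<open>A point in the relative interior of the face. Its zero slacks recover \<open>N\<close>,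
  so it serves as a test point when faces are compared.\<close>

lemma ex_point_with_zeros:
  assumes "admissible N"
  obtains x where "x \<in> C" "{k. k < p \<and> slack k x = 0} = N"
  using assms
proof (cases rule: admissible_cases)
  case empty
  \<comment> \<open>The centroid of three consecutive vertices, nested so that
    \<open>slack_affine\<close> applies. No edge contains all three.\<close>
  define x where "x = (1 - 1/3) *\<^sub>R ((1 - 1/2) *\<^sub>R vert 0 + (1/2) *\<^sub>R vert (nxt 0)) + (1/3) *\<^sub>R vert (nxt (nxt 0))"
  have p0: "0 < p" using p3 by simp
  have pos: "0 < slack k x" if "k < p" for k
  proof -
    have "0 \<le> slack k (vert 0)" "0 \<le> slack k (vert (nxt 0))" "0 \<le> slack k (vert (nxt (nxt 0)))"
      using that p0 by (auto intro!: slack_nonneg vert_C)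
    moreover have "\<not> (slack k (vert 0) = 0 \<and> slack k (vert (nxt 0)) = 0 \<and> slack k (vert (nxt (nxt 0))) = 0)"
    proof
      assume "slack k (vert 0) = 0 \<and> slack k (vert (nxt 0)) = 0 \<and> slack k (vert (nxt (nxt 0))) = 0"
      then have "k = 0 \<or> k = nxt 0" "k = nxt 0 \<or> k = nxt (nxt 0)"
        "k = nxt (nxt 0) \<or> k = nxt (nxt (nxt 0))"
        using slack_vert that p0 by auto
      then show False
        using nxt_neq[of 0] nxt_neq[of "nxt 0"] nxt_nxt_neq[of 0] nxt_nxt_neq[of "nxt 0"] p0 by auto
    qed
    ultimately have "0 < slack k (vert 0) + slack k (vert (nxt 0)) + slack k (vert (nxt (nxt 0)))" by linarith
    then show ?thesis unfolding x_def slack_affine by (simp add: field_simps)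
  qed
  then show ?thesis
    by (intro that[of x]) (use empty in \<open>auto simp: C_iff less_imp_le\<close>, force)
next
  case (edge i)
  obtain m where m: "m < p" "i = nxt m" using ex_nxt edge by blast
  define x where "x = (1 - 1/2) *\<^sub>R vert m + (1/2) *\<^sub>R vert i"
  have tx: "slack k x = (slack k (vert m) + slack k (vert i)) / 2" for k
    unfolding x_def slack_affine by simp
  have nn: "0 \<le> slack k (vert m)" "0 \<le> slack k (vert i)" if "k < p" for k
    using that m edge by (auto intro!: slack_nonneg vert_C)
  have "slack k x = 0 \<longleftrightarrow> k = i" if "k < p" for k
  proof -
    have "slack k x = 0 \<longleftrightarrow> slack k (vert m) = 0 \<and> slack k (vert i) = 0"
      using nn[OF that] unfolding tx by auto
    also have "\<dots> \<longleftrightarrow> k = i"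
      using slack_vert[OF m(1) that] slack_vert[OF edge(1) that] m by auto
    finally show ?thesis .
  qed
  then show ?thesis
    using nn edge by (intro that[of x]) (auto simp: C_iff tx)
next
  case (vertex i)
  then show ?thesis using slack_vert vert_C by (intro that[of "vert i"]) auto
qed

text \<open>The normals of two consecutive edges are independent, so they have a dual basis. The
  sign makes \<open>e\<close> and \<open>e'\<close> each increase one of the two slacks at unit rate
  and keep the other: the slacks become coordinates at the corner.\<close>

lemma corner_directions:
  assumes "i < p"
  obtains e e' where "a i \<bullet> e = - 1" "a (nxt i) \<bullet> e = 0" "a i \<bullet> e' = 0" "a (nxt i) \<bullet> e' = - 1"
    and "\<And>d. a i \<bullet> d = 0 \<Longrightarrow> a (nxt i) \<bullet> d = 0 \<Longrightarrow> d = 0"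
proof -
  obtain x where x: "x \<in> E i" "slack (nxt i) x > 0" using E_not_subset[of i "nxt i"] assms by auto
  \<comment> \<open>If this determinant vanished, the direction from the corner along edge
    \<open>i\<close> would also run along edge \<open>nxt i\<close>, against
    \<open>slack (nxt i) x > 0\<close>. The two vectors below then come from Cramer's rule.\<close>
  define D where "D = a i $ 1 * a (nxt i) $ 2 - a i $ 2 * a (nxt i) $ 1"
  have "a i \<bullet> vert i = 1" "a (nxt i) \<bullet> vert i = 1" using vert_mem assms by (auto simp: E_iff slack_def)
  then have "a i \<bullet> (x - vert i) = 0" "a (nxt i) \<bullet> (x - vert i) \<noteq> 0" "a i \<noteq> 0"
    using x by (auto simp: inner_diff_right E_iff slack_def)
  then have D: "D \<noteq> 0" using parallel_imp_orthogonal[of "a i" "a (nxt i)"] by (auto simp: D_def)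
  show ?thesis
  proof (rule that[of "vector [- a (nxt i) $ 2 / D, a (nxt i) $ 1 / D]"
        "vector [a i $ 2 / D, - a i $ 1 / D]"])
    fix d assume "a i \<bullet> d = 0" "a (nxt i) \<bullet> d = 0"
    then have "D * d $ 1 = 0" "D * d $ 2 = 0"
      by (auto simp: D_def inner_vec_def sum_2) algebra+
    then show "d = 0" using D by (auto simp: vec_eq_iff forall_2)
  qed (use D in \<open>auto simp: inner_vec_def sum_2 field_simps\<close>; simp add: D_def algebra_simps)+
qed

end


section \<open>Simplices\<close>

text \<open>The vertex \<open>w j\<close> is the one missing from facet \<open>j\<close>. For the
  third property, \<open>q\<close> affinely independent points span a space of dimension
  \<open>q - 1\<close>; pairing the affine coordinates of \<open>w j + d\<close> with
  \<open>b k\<close> kills the weight of \<open>w k\<close> for each \<open>k\<close> other than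
  \<open>j\<close>, so \<open>w j + d = w j\<close>.\<close>

lemma simplex_presentation_vertices:
  fixes b :: "nat \<Rightarrow> 'a::euclidean_space"
  assumes "q \<ge> 1" and "DIM('a) = q - 1" and "simplex_presentation q b"
  obtains w where "\<And>j k. j < q \<Longrightarrow> k < q \<Longrightarrow> k \<noteq> j \<Longrightarrow> b k \<bullet> w j = 1"
    and "\<And>j. j < q \<Longrightarrow> b j \<bullet> w j < 1"
    and "\<And>j d. j < q \<Longrightarrow> (\<And>k. k < q \<Longrightarrow> k \<noteq> j \<Longrightarrow> b k \<bullet> d = 0) \<Longrightarrow> d = 0"
proof -
  have "(int q - 1) simplex (ineq_polyhedron q b)"
    and bij: "bij_betw (ineq_face q b) {..<q} {F. F facet_of ineq_polyhedron q b}"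
    using assms(3) by (auto simp: simplex_presentation_def facet_inequalities_def)
  then obtain S where S: "\<not> affine_dependent S" "card S = q" "ineq_polyhedron q b = convex hull S"
    unfolding simplex_def by auto
  have fin: "finite S"
    by (rule aff_independent_finite[OF S(1)])
  have "\<forall>j\<in>{..<q}. \<exists>u\<in>S. ineq_face q b j = convex hull (S - {u})"
  proof
    fix j assume "j \<in> {..<q}"
    then have "ineq_face q b j facet_of convex hull S"
      using bij_betwE[OF bij] S(3) by auto
    then show "\<exists>u\<in>S. ineq_face q b j = convex hull (S - {u})"
      unfolding facet_of_convex_hull_affine_independent[OF S(1)] by blast
  qed
  then obtain w where w: "\<And>j. j < q \<Longrightarrow> w j \<in> S"
    "\<And>j. j < q \<Longrightarrow> ineq_face q b j = convex hull (S - {w j})"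
    by (metis lessThan_iff)
  have inj: "inj_on w {..<q}"
    using bij w(2) unfolding bij_betw_def inj_on_def by (metis lessThan_iff)
  have wS: "w ` {..<q} = S"
    by (rule card_subset_eq) (use fin w(1) S(2) card_image[OF inj] in auto)
  have one: "b k \<bullet> w j = 1" if "j < q" "k < q" "k \<noteq> j" for j k
  proof -
    have "w j \<in> S - {w k}"
      using that w(1) inj by (auto simp: inj_on_def)
    then have "w j \<in> ineq_face q b k"
      unfolding w(2)[OF that(2)] by (rule hull_inc)
    then show ?thesis by (simp add: ineq_face_def)
  qed
  have less: "b j \<bullet> w j < 1" if "j < q" for j
  proof -
    have "w j \<notin> affine hull (S - {w j})"
      using S(1) w(1)[OF that] by (auto simp: affine_dependent_def)
    then have "w j \<notin> ineq_face q b j"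
      unfolding w(2)[OF that] using convex_hull_subset_affine_hull by blast
    moreover have "w j \<in> ineq_polyhedron q b"
      unfolding S(3) by (rule hull_inc[OF w(1)[OF that]])
    ultimately show ?thesis
      using that by (force simp: ineq_face_def ineq_polyhedron_def)
  qed
  have zero: "d = 0" if j: "j < q" and d: "\<And>k. k < q \<Longrightarrow> k \<noteq> j \<Longrightarrow> b k \<bullet> d = 0" for j d
  proof -
    have "affine hull S = UNIV"
      by (rule affine_independent_span_eq[OF S(1)]) (use S(2) assms in auto)
    then have "w j + d \<in> affine hull S" by simp
    then obtain u where u: "sum u S = 1" "(\<Sum>x\<in>S. u x *\<^sub>R x) = w j + d"
      unfolding affine_hull_finite[OF fin] by auto
    have u0: "u x = 0" if x: "x \<in> S" "x \<noteq> w j" for x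
    proof -
      obtain k where k: "k < q" "x = w k" using x wS by auto
      have kj: "k \<noteq> j" using k x by auto
      have "1 = b k \<bullet> (w j + d)"
        using one[OF j k(1) kj] d[OF k(1) kj] by (simp add: inner_add_right)
      also have "\<dots> = (\<Sum>y\<in>S. u y * (b k \<bullet> y))"
        by (simp add: u(2)[symmetric] inner_sum_right)
      \<comment> \<open>The normal \<open>b k\<close> takes the value 1 at all vertices except
        \<open>w k\<close>, so only that term deviates from the plain sum of the weights.\<close>
      also have "\<dots> = (\<Sum>y\<in>S. u y - (if y = w k then u y * (1 - b k \<bullet> w k) else 0))"
      proof (rule sum.cong[OF refl])
        fix y assume "y \<in> S"
        then obtain l where "l < q" "y = w l" using wS by auto
        then show "u y * (b k \<bullet> y) = u y - (if y = w k then u y * (1 - b k \<bullet> w k) else 0)"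
          using one[of l k] k(1) by (cases "l = k") (auto simp: algebra_simps)
      qed
      also have "\<dots> = 1 - u (w k) * (1 - b k \<bullet> w k)"
        using fin w(1)[OF k(1)] by (simp add: sum_subtractf u(1))
      finally show ?thesis using less[OF k(1)] k(2) by auto
    qed
    have "sum u S = (\<Sum>x\<in>{w j}. u x)"
      by (rule sum.mono_neutral_right) (use fin w(1)[OF j] u0 in auto)
    then have "u (w j) = 1" using u(1) by simp
    moreover have "(\<Sum>x\<in>S. u x *\<^sub>R x) = (\<Sum>x\<in>{w j}. u x *\<^sub>R x)"
      by (rule sum.mono_neutral_right) (use fin w(1)[OF j] u0 in auto)
    ultimately show ?thesis using u(2) by simp
  qed
  show ?thesis using that one less zero by blast
qed


section \<open>A fan of rays in the plane\<close>

text \<open>Directions at the multiples of pi/q, hence 2q rays in all. Integer indices, read modulo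
  2q, spare the wrap-around in index arithmetic.\<close>

definition ray :: "nat \<Rightarrow> int \<Rightarrow> real^2" where
  "ray q m = vector [cos (of_int m * (pi / real q)), sin (of_int m * (pi / real q))]"

definition det2 :: "real^2 \<Rightarrow> real^2 \<Rightarrow> real" where
  "det2 x y = x $ 1 * y $ 2 - x $ 2 * y $ 1"

text \<open>The function that is linear on each cone between consecutive rays, equal to \<open>1\<close> at the
  \<open>m\<close>-th ray and to \<open>0\<close> at all others; see \<open>hat_cone\<close> below.\<close>

definition hat :: "nat \<Rightarrow> int \<Rightarrow> real^2 \<Rightarrow> real" where
  "hat q m z = max 0 (min (det2 (ray q (m - 1)) z) (det2 z (ray q (m + 1)))) / sin (pi / real q)"

lemma det2_ray: "det2 (ray q l) (ray q m) = sin (of_int (m - l) * (pi / real q))"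
  by (simp add: det2_def ray_def left_diff_distrib sin_diff algebra_simps)

lemma det2_linear_right:
  "det2 x (s *\<^sub>R y + t *\<^sub>R z) = s * det2 x y + t * det2 x z"
  by (simp add: det2_def algebra_simps)

lemma det2_linear_left:
  "det2 (s *\<^sub>R y + t *\<^sub>R z) x = s * det2 y x + t * det2 z x"
  by (simp add: det2_def algebra_simps)

lemma ray_periodic:
  assumes "q > 0" "[m = l] (mod (2 * int q))"
  shows "ray q m = ray q l"
proof -
  obtain k where k: "m = l + 2 * int q * k"
    using assms(2) by (auto simp: cong_iff_dvd_diff dvd_def algebra_simps)
  have e: "of_int m * (pi / real q) = of_int l * (pi / real q) + (2 * pi) * of_int k"
    using assms(1) by (simp add: k field_simps)
  show ?thesis
    unfolding ray_def e sin_add cos_add sin_int_2pin cos_int_2pin by simp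
qed

lemma hat_periodic:
  assumes "q > 0" "[m = l] (mod (2 * int q))"
  shows "hat q m = hat q l"
proof -
  have "ray q (m - 1) = ray q (l - 1)" "ray q (m + 1) = ray q (l + 1)"
    using assms by (auto intro!: ray_periodic cong_diff cong_add)
  then show ?thesis by (simp add: hat_def fun_eq_iff)
qed

lemma continuous_on_hat: "continuous_on A (hat q m)"
  unfolding hat_def[abs_def] det2_def divide_inverse by (intro continuous_intros)

lemma sin_multiple_nonneg:
  assumes "0 \<le> d" "d \<le> int q"
  shows "0 \<le> sin (of_int d * (pi / real q))"
proof (cases "q = 0")
  case False
  show ?thesis
    by (rule sin_ge_zero) (use assms False in \<open>auto simp: field_simps\<close>)
qed auto

lemma sin_multiple_nonpos:
  assumes "int q \<le> d" "d \<le> 2 * int q" "q > 0"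
  shows "sin (of_int d * (pi / real q)) \<le> 0"
proof -
  have "0 \<le> sin (of_int (d - int q) * (pi / real q))"
    by (rule sin_multiple_nonneg) (use assms in auto)
  also have "of_int (d - int q) * (pi / real q) = of_int d * (pi / real q) - pi"
    using assms by (simp add: field_simps)
  finally show ?thesis by simp
qed

text \<open>Shifting \<open>m\<close> by a multiple of 2q puts it \<open>d\<close> steps before
  \<open>l\<close>, with \<open>d\<close> below 2q. Signs of sines then decide: the cone starts at
  ray \<open>m\<close> (\<open>d = 0\<close>), ends there (\<open>d = 2 * int q - 1\<close>), or
  lies where one of the two determinants is at most 0.\<close>

lemma hat_cone:
  assumes q: "q \<ge> 2" and st: "s \<ge> 0" "t \<ge> 0"
  shows "hat q m (s *\<^sub>R ray q l + t *\<^sub>R ray q (l + 1)) =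
    (if [m = l] (mod (2 * int q)) then s else if [m = l + 1] (mod (2 * int q)) then t else 0)"
proof -
  define \<alpha> where "\<alpha> = pi / real q"
  have sin_pos: "sin \<alpha> > 0"
    unfolding \<alpha>_def by (rule sin_gt_zero) (use q in \<open>auto simp: field_simps\<close>)
  define d where "d = (l - m) mod (2 * int q)"
  have d_bounds: "0 \<le> d" "d < 2 * int q" using q by (auto simp: d_def)
  define m' where "m' = l - d"
  have cong_m: "[m = m'] (mod (2 * int q))"
    unfolding m'_def d_def by (simp add: cong_def mod_diff_right_eq)
  have lm: "l = m' + d" by (simp add: m'_def)
  have A: "det2 (ray q (m' - 1)) (s *\<^sub>R ray q l + t *\<^sub>R ray q (l + 1)) =
      s * sin (of_int (d + 1) * \<alpha>) + t * sin (of_int (d + 2) * \<alpha>)"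
    by (simp add: det2_linear_right det2_ray lm \<alpha>_def algebra_simps)
  have "det2 (s *\<^sub>R ray q l + t *\<^sub>R ray q (l + 1)) (ray q (m' + 1)) =
      s * sin (of_int (- (d - 1)) * \<alpha>) + t * sin (of_int (- d) * \<alpha>)"
    by (simp add: det2_linear_left det2_ray lm \<alpha>_def algebra_simps)
  also have "\<dots> = - (s * sin (of_int (d - 1) * \<alpha>) + t * sin (of_int d * \<alpha>))"
    using sin_minus[of "of_int (d - 1) * \<alpha>"] by (simp add: algebra_simps)
  finally have B: "det2 (s *\<^sub>R ray q l + t *\<^sub>R ray q (l + 1)) (ray q (m' + 1)) =
      - (s * sin (of_int (d - 1) * \<alpha>) + t * sin (of_int d * \<alpha>))" .
  have H: "hat q m (s *\<^sub>R ray q l + t *\<^sub>R ray q (l + 1)) =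
    max 0 (min (s * sin (of_int (d + 1) * \<alpha>) + t * sin (of_int (d + 2) * \<alpha>))
       (- (s * sin (of_int (d - 1) * \<alpha>) + t * sin (of_int d * \<alpha>)))) / sin \<alpha>"
  proof -
    have "hat q m = hat q m'" by (rule hat_periodic[OF _ cong_m]) (use q in simp)
    then show ?thesis unfolding hat_def[of q m'] A B by (simp only: hat_def \<alpha>_def A B)
  qed
  have ml: "[m = l] (mod (2 * int q)) \<longleftrightarrow> d = 0"
  proof -
    have "[m = l] (mod (2 * int q)) \<longleftrightarrow> [m' = m' + d] (mod (2 * int q))"
      using cong_m unfolding lm by (metis cong_sym cong_trans)
    also have "\<dots> \<longleftrightarrow> 2 * int q dvd d"
      by (simp add: cong_iff_dvd_diff)
    also have "\<dots> \<longleftrightarrow> d = 0"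
      using d_bounds zdvd_not_zless[of d "2 * int q"] by fastforce
    finally show ?thesis .
  qed
  have ml1: "[m = l + 1] (mod (2 * int q)) \<longleftrightarrow> d = 2 * int q - 1"
  proof -
    have "[m = l + 1] (mod (2 * int q)) \<longleftrightarrow> [m' = m' + (d + 1)] (mod (2 * int q))"
      using cong_m unfolding lm add.assoc by (metis cong_sym cong_trans)
    also have "\<dots> \<longleftrightarrow> 2 * int q dvd d + 1"
      unfolding cong_iff_dvd_diff using dvd_minus_iff[of "2 * int q" "d + 1"] by (simp add: algebra_simps)
    also have "\<dots> \<longleftrightarrow> d = 2 * int q - 1"
      using d_bounds zdvd_imp_le[of "2 * int q" "d + 1"] by auto
    finally show ?thesis .
  qed
  consider "d = 0" | "1 \<le> d" "d \<le> int q - 1" | "int q \<le> d" "d \<le> 2 * int q - 2" | "d = 2 * int q - 1"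
    using d_bounds by linarith
  then show ?thesis
  proof cases
    case 1
    \<comment> \<open>As q is at least 2, the angle \<open>2 * \<alpha>\<close> is at most pi, so
      the determinant with ray \<open>m - 1\<close> is not the smaller one.\<close>
    have "0 \<le> sin (of_int 2 * \<alpha>)"
      unfolding \<alpha>_def by (rule sin_multiple_nonneg) (use q in auto)
    then have "min (s * sin \<alpha> + t * sin (2 * \<alpha>)) (s * sin \<alpha>) = s * sin \<alpha>"
      using st by simp
    then show ?thesis
      unfolding H ml using 1 st sin_pos by simp
  next
    case 2
    have "0 \<le> sin (of_int (d - 1) * \<alpha>)" "0 \<le> sin (of_int d * \<alpha>)"
      unfolding \<alpha>_def by (rule sin_multiple_nonneg; use 2 in simp)+
    then have "0 \<le> s * sin (of_int (d - 1) * \<alpha>) + t * sin (of_int d * \<alpha>)"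
      using st by simp
    then show ?thesis
      unfolding H ml ml1 using 2 by (simp add: max_def min_def)
  next
    case 3
    have "sin (of_int (d + 1) * \<alpha>) \<le> 0" "sin (of_int (d + 2) * \<alpha>) \<le> 0"
      unfolding \<alpha>_def by (rule sin_multiple_nonpos; use 3 q in simp)+
    then have "s * sin (of_int (d + 1) * \<alpha>) + t * sin (of_int (d + 2) * \<alpha>) \<le> 0"
      using st by (simp add: add_nonpos_nonpos mult_nonneg_nonpos)
    then show ?thesis
      unfolding H ml ml1 using 3 q by (simp add: max_def min_def)
  next
    case 4
    have per: "sin (of_int (2 * int q + k) * \<alpha>) = sin (of_int k * \<alpha>)" for k
    proof -
      have "of_int (2 * int q + k) * \<alpha> = of_int k * \<alpha> + 2 * pi"
        using q by (simp add: \<alpha>_def field_simps)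
      then show ?thesis by simp
    qed
    have "d + 1 = 2 * int q + 0" "d + 2 = 2 * int q + 1" "d - 1 = 2 * int q + (- 2)"
      "d = 2 * int q + (- 1)" using 4 by auto
    then have S: "sin (of_int (d + 1) * \<alpha>) = 0" "sin (of_int (d + 2) * \<alpha>) = sin \<alpha>"
      "sin (of_int (d - 1) * \<alpha>) = - sin (2 * \<alpha>)" "sin (of_int d * \<alpha>) = - sin \<alpha>"
      using per[of 0] per[of 1] per[of "- 2"] per[of "- 1"] by (simp_all add: add.commute)
    have "0 \<le> sin (of_int 2 * \<alpha>)"
      unfolding \<alpha>_def by (rule sin_multiple_nonneg) (use q in auto)
    then have "min (t * sin \<alpha>) (s * sin (2 * \<alpha>) + t * sin \<alpha>) = t * sin \<alpha>"
      using st by simp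
    then show ?thesis
      unfolding H ml ml1 unfolding S using 4 st sin_pos q by (simp add: add.commute)
  qed
qed

text \<open>Polar coordinates: \<open>m\<close> counts the full steps of \<alpha> in the angle, and
  the law of sines gives the coefficients along the two neighbouring rays.\<close>

lemma ex_cone:
  assumes q: "q \<ge> 2"
  obtains m s t where "0 \<le> s" "0 \<le> t" "z = s *\<^sub>R ray q m + t *\<^sub>R ray q (m + 1)"
proof -
  define \<alpha> where "\<alpha> = pi / real q"
  have sin_pos: "sin \<alpha> > 0" and \<alpha>: "0 < \<alpha>" "\<alpha> < pi"
    unfolding \<alpha>_def using q by (auto simp: field_simps intro!: sin_gt_zero)
  obtain \<rho> \<theta> where z: "\<rho> \<ge> 0" "z $ 1 = \<rho> * cos \<theta>" "z $ 2 = \<rho> * sin \<theta>"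
  proof -
    have "Complex (z $ 1) (z $ 2) = rcis (cmod (Complex (z $ 1) (z $ 2))) (Arg (Complex (z $ 1) (z $ 2)))"
      by (simp add: rcis_cmod_Arg)
    then show ?thesis
      using that[of "cmod (Complex (z $ 1) (z $ 2))" "Arg (Complex (z $ 1) (z $ 2))"]
      by (metis complex.sel norm_ge_zero Re_rcis Im_rcis)
  qed
  define m where "m = \<lfloor>\<theta> / \<alpha>\<rfloor>"
  define \<phi> where "\<phi> = \<theta> - of_int m * \<alpha>"
  have \<phi>: "0 \<le> \<phi>" "\<phi> \<le> \<alpha>"
  proof -
    have "of_int m \<le> \<theta> / \<alpha>" "\<theta> / \<alpha> \<le> of_int m + 1"
      unfolding m_def by linarith+
    then show "0 \<le> \<phi>" "\<phi> \<le> \<alpha>"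
      using \<alpha> by (auto simp: \<phi>_def pos_le_divide_eq pos_divide_le_eq algebra_simps)
  qed
  have \<theta>: "\<theta> = of_int m * \<alpha> + \<phi>" by (simp add: \<phi>_def)
  show ?thesis
  proof (rule that)
    show "0 \<le> \<rho> * sin (\<alpha> - \<phi>) / sin \<alpha>" "0 \<le> \<rho> * sin \<phi> / sin \<alpha>"
      using z(1) sin_pos \<phi> \<alpha> by (auto intro!: divide_nonneg_pos mult_nonneg_nonneg sin_ge_zero)
    have c: "sin \<alpha> * cos (x + \<phi>) = sin (\<alpha> - \<phi>) * cos x + sin \<phi> * cos (x + \<alpha>)"
      and s: "sin \<alpha> * sin (x + \<phi>) = sin (\<alpha> - \<phi>) * sin x + sin \<phi> * sin (x + \<alpha>)" for x
      by (simp_all add: sin_add cos_add sin_diff algebra_simps)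
    have "z $ 1 = \<rho> * (sin \<alpha> * cos (of_int m * \<alpha> + \<phi>)) / sin \<alpha>"
      "z $ 2 = \<rho> * (sin \<alpha> * sin (of_int m * \<alpha> + \<phi>)) / sin \<alpha>"
      using z sin_pos by (auto simp: \<theta>)
    then show "z = (\<rho> * sin (\<alpha> - \<phi>) / sin \<alpha>) *\<^sub>R ray q m + (\<rho> * sin \<phi> / sin \<alpha>) *\<^sub>R ray q (m + 1)"
      unfolding c s by (simp add: vec_eq_iff forall_2 ray_def \<alpha>_def[symmetric] ring_distribs add_divide_distrib mult.assoc)
  qed
qed

text \<open>Even and odd rays are shared out: \<open>u m\<close> has index \<open>2 m\<close> and
  \<open>u' n\<close> has index \<open>2 (c - n) + 1\<close>. The neighbours of the latter are the
  even rays \<open>2 (c - n)\<close> and \<open>2 (c - n + 1)\<close>, that is, \<open>m\<close> is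
  \<open>c - n\<close> or \<open>c - n + 1\<close> modulo q. So the cones of the fan are exactly the
  pairs with sum \<open>c\<close> or \<open>c + 1\<close>.\<close>

lemma ex_alternating_fan:
  fixes c :: int
  assumes q: "q \<ge> 2"
  obtains u u' :: "nat \<Rightarrow> real^2" and f f' :: "nat \<Rightarrow> real^2 \<Rightarrow> real"
  where "\<And>n. continuous_on UNIV (f n)" and "\<And>n. continuous_on UNIV (f' n)"
    and "\<And>z. \<exists>m n s t. m < q \<and> n < q \<and> 0 \<le> s \<and> 0 \<le> t \<and>
          ([int m + int n = c] (mod int q) \<or> [int m + int n = c + 1] (mod int q)) \<and>
          z = s *\<^sub>R u m + t *\<^sub>R u' n"
    and "\<And>m n s t k. \<lbrakk>m < q; n < q; k < q; 0 \<le> s; 0 \<le> t;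
          [int m + int n = c] (mod int q) \<or> [int m + int n = c + 1] (mod int q)\<rbrakk> \<Longrightarrow>
          f k (s *\<^sub>R u m + t *\<^sub>R u' n) = (if k = m then s else 0) \<and>
          f' k (s *\<^sub>R u m + t *\<^sub>R u' n) = (if k = n then t else 0)"
proof -
  define u where "u n = ray q (2 * int n)" for n
  define u' where "u' n = ray q (2 * (c - int n) + 1)" for n
  have q0: "q > 0" using q by simp
  have cong2: "[2 * x = 2 * y] (mod (2 * int q)) \<longleftrightarrow> [x = y] (mod int q)" for x y :: int
    by (simp add: cong_def mult_mod_right[symmetric])
  have cong2': "[2 * x + 1 = 2 * y + 1] (mod (2 * int q)) \<longleftrightarrow> [x = y] (mod int q)" for x y :: int
    using cong2 by (simp add: cong_iff_dvd_diff)
  have odd: "\<not> [2 * x = 2 * y + 1] (mod (2 * int q))" for x y :: int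
  proof
    assume "[2 * x = 2 * y + 1] (mod (2 * int q))"
    then have "2 * int q dvd 2 * (x - y) - 1" by (simp add: cong_iff_dvd_diff algebra_simps)
    then have "2 dvd 2 * (x - y) - 1" by (rule dvd_mult_left)
    then show False by presburger
  qed
  have odd': "\<not> [2 * x + 1 = 2 * y] (mod (2 * int q))" for x y :: int
    using odd[of y x] cong_sym by blast
  have small: "[int k = int m] (mod int q) \<longleftrightarrow> k = m" if "k < q" "m < q" for k m
    using that by (simp add: cong_int_iff) (simp add: cong_def)
  have smallc: "[c - int k = c - int n] (mod int q) \<longleftrightarrow> k = n" if "k < q" "n < q" for k n
    using small[OF that(2,1)] by (auto simp: cong_iff_dvd_diff)
  show ?thesis
  proof (rule that[of "\<lambda>n. hat q (2 * int n)" "\<lambda>n. hat q (2 * (c - int n) + 1)" u u'])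
    fix z
    obtain m s t where z: "0 \<le> s" "0 \<le> t" "z = s *\<^sub>R ray q m + t *\<^sub>R ray q (m + 1)"
      by (rule ex_cone[OF q])
    define md where "md x = nat (x mod int q)" for x
    have md: "md x < q" "[int (md x) = x] (mod int q)" for x
      using q0 by (auto simp: md_def cong_def nat_less_iff)
    have u: "u (md x) = ray q (2 * x)" for x
      unfolding u_def by (rule ray_periodic[OF q0]) (use md cong2 in auto)
    have u': "u' (md x) = ray q (2 * (c - x) + 1)" for x
      unfolding u'_def by (rule ray_periodic[OF q0]) (unfold cong2', use md in \<open>auto intro!: cong_diff\<close>)
    have sum: "[int (md x) + int (md y) = x + y] (mod int q)" for x y
      by (rule cong_add) (use md in auto)
    show "\<exists>m n s t. m < q \<and> n < q \<and> 0 \<le> s \<and> 0 \<le> t \<and>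
          ([int m + int n = c] (mod int q) \<or> [int m + int n = c + 1] (mod int q)) \<and>
          z = s *\<^sub>R u m + t *\<^sub>R u' n"
    \<comment> \<open>An even ray belongs to \<open>u\<close> and the next one to \<open>u'\<close>;
      starting from an odd ray, the roles and hence the coefficients are exchanged.\<close>
    proof (cases "even m")
      case True
      then obtain k where k: "m = 2 * k" by auto
      show ?thesis
        by (rule exI[of _ "md k"], rule exI[of _ "md (c - k)"], rule exI[of _ s], rule exI[of _ t])
          (use z md sum[of k "c - k"] k in \<open>simp add: u u'\<close>)
    next
      case False
      then obtain k where k: "m = 2 * k + 1" by (auto elim: oddE)
      then have "m + 1 = 2 * (k + 1)" by simp
      then show ?thesis
        by (intro exI[of _ "md (k + 1)"] exI[of _ "md (c - k)"] exI[of _ t] exI[of _ s])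
          (use z md sum[of "k + 1" "c - k"] k in \<open>simp add: u u' add.commute\<close>)
    qed
  next
    fix m n k :: nat and s t :: real
    assume mn: "m < q" "n < q" "k < q" "0 \<le> s" "0 \<le> t"
      and "[int m + int n = c] (mod int q) \<or> [int m + int n = c + 1] (mod int q)"
    then consider "[int m = c - int n] (mod int q)" | "[int m = c - int n + 1] (mod int q)"
      by (auto simp: cong_iff_dvd_diff algebra_simps)
    then show "hat q (2 * int k) (s *\<^sub>R u m + t *\<^sub>R u' n) = (if k = m then s else 0) \<and>
      hat q (2 * (c - int k) + 1) (s *\<^sub>R u m + t *\<^sub>R u' n) = (if k = n then t else 0)"
    proof cases
      case 1
      have "u' n = ray q (2 * int m + 1)"
        unfolding u'_def by (rule ray_periodic[OF q0]) (unfold cong2', rule cong_sym[OF 1])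
      moreover have e: "[c - int k = int m] (mod int q) \<longleftrightarrow> k = n"
        using smallc[OF mn(3,2)] 1 by (meson cong_sym cong_trans)
      ultimately show ?thesis
        unfolding u_def by (simp only: hat_cone[OF q mn(4,5)] cong2 cong2' odd odd' small[OF mn(3,1)] e if_False simp_thms)
    next
      case 2
      \<comment> \<open>Here the odd ray of \<open>n\<close> comes first and the even ray of
        \<open>m\<close> second, so \<open>hat_cone\<close> is applied with \<open>s\<close> and
        \<open>t\<close> interchanged.\<close>
      define l where "l = 2 * (c - int n) + 1"
      have um: "u m = ray q (l + 1)"
        unfolding u_def l_def using 2 cong2[of "int m" "c - int n + 1"]
        by (intro ray_periodic[OF q0]) (simp add: algebra_simps)
      have l1: "l + 1 = 2 * (c - int n + 1)" by (simp add: l_def)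
      have e: "[int k = c - int n + 1] (mod int q) \<longleftrightarrow> k = m"
        using small[OF mn(3,1)] 2 by (meson cong_sym cong_trans)
      have "s *\<^sub>R u m + t *\<^sub>R u' n = t *\<^sub>R ray q l + s *\<^sub>R ray q (l + 1)"
        unfolding um u'_def l_def[symmetric] by simp
      moreover have "hat q (2 * int k) (t *\<^sub>R ray q l + s *\<^sub>R ray q (l + 1)) = (if k = m then s else 0)"
        unfolding hat_cone[OF q mn(5,4)] unfolding l1 cong2 e unfolding l_def by (simp only: odd if_False)
      moreover have "hat q (2 * (c - int k) + 1) (t *\<^sub>R ray q l + s *\<^sub>R ray q (l + 1)) = (if k = n then t else 0)"
        unfolding hat_cone[OF q mn(5,4)] unfolding l1 unfolding l_def cong2'
        by (simp only: odd' smallc[OF mn(3,2)] if_False)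
      ultimately show ?thesis by simp
    qed
  qed (auto intro: continuous_on_hat)
qed


section \<open>The polygons of the surface\<close>

text \<open>The simplex enters through its normals \<open>b\<close> and its vertices
  \<open>w\<close>, where \<open>w j\<close> lies on every facet but the \<open>j\<close>-th. The
  last assumption says that the equations of these facets determine \<open>w j\<close>.\<close>

locale wedge_surface = cyclic_polygon p a
  for p and a +
  fixes q :: nat and b w :: "nat \<Rightarrow> real^'r" and \<iota> :: "nat \<Rightarrow> 'p::finite"
  assumes q2: "q \<ge> 2"
    and bij_\<iota>: "bij_betw \<iota> {..<p} UNIV"
    and b_w: "\<And>j k. j < q \<Longrightarrow> k < q \<Longrightarrow> k \<noteq> j \<Longrightarrow> b k \<bullet> w j = 1"
    and b_w_less: "\<And>j. j < q \<Longrightarrow> b j \<bullet> w j < 1"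
    and w_unique: "\<And>j d. j < q \<Longrightarrow> (\<And>k. k < q \<Longrightarrow> k \<noteq> j \<Longrightarrow> b k \<bullet> d = 0) \<Longrightarrow> d = 0"
begin

section \<open>Graphs over the polygon as affine copies of it\<close>

abbreviation blk :: "'p \<Rightarrow> nat" where "blk \<equiv> inv_into {..<p} \<iota>"

lemma blk_\<iota> [simp]: "k < p \<Longrightarrow> blk (\<iota> k) = k"
  using bij_\<iota> by (auto simp: bij_betw_def inv_into_f_f)

lemma blk_less [simp]: "blk m < p" and \<iota>_blk [simp]: "\<iota> (blk m) = m"
proof -
  have "m \<in> \<iota> ` {..<p}" using bij_\<iota> by (simp add: bij_betw_def)
  from inv_into_into[OF this] f_inv_into_f[OF this] show "blk m < p" "\<iota> (blk m) = m" by auto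
qed

lemma block_eq_iff: "y = z \<longleftrightarrow> (\<forall>k<p. y $ \<iota> k = z $ \<iota> k)"
  by (metis \<iota>_blk blk_less vec_eq_iff)

lemma scaleR_w_eq_iff:
  assumes "s \<noteq> 0 \<Longrightarrow> j < q" "s \<noteq> 0 \<Longrightarrow> l < q"
  shows "s *\<^sub>R w j = s *\<^sub>R w l \<longleftrightarrow> s = 0 \<or> j = l"
proof -
  have "j = l" if "j < q" "l < q" "w j = w l"
    using b_w[OF that(2,1)] b_w_less[OF that(1)] that(3) by force
  then show ?thesis using assms by auto
qed

definition lift :: "(nat \<Rightarrow> nat) \<Rightarrow> real^2 \<Rightarrow> (real^2) \<times> (real^'r^'p)" where
  "lift j x = (x, \<chi> m. slack (blk m) x *\<^sub>R w (j (blk m)))"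

lemma fst_lift [simp]: "fst (lift j x) = x"
  by (simp add: lift_def)

lemma snd_lift [simp]: "k < p \<Longrightarrow> snd (lift j x) $ \<iota> k = slack k x *\<^sub>R w (j k)"
  by (simp add: lift_def)

text \<open>The bounds are demanded only where the slack is nonzero: \<open>lift\<close> is later
  applied to partial maps made total by \<open>the\<close>, whose values at undefined indices are
  arbitrary and get multiplied by 0.\<close>

lemma lift_eq_iff:
  assumes "\<And>k. k < p \<Longrightarrow> slack k x \<noteq> 0 \<Longrightarrow> j k < q" "\<And>k. k < p \<Longrightarrow> slack k x \<noteq> 0 \<Longrightarrow> j' k < q"
  shows "lift j x = lift j' x' \<longleftrightarrow> x = x' \<and> (\<forall>k<p. slack k x = 0 \<or> j k = j' k)"
proof -
  have "lift j x = lift j' x' \<longleftrightarrow>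
      x = x' \<and> (\<forall>k<p. snd (lift j x) $ \<iota> k = snd (lift j' x') $ \<iota> k)"
    by (simp add: prod_eq_iff block_eq_iff)
  also have "\<dots> \<longleftrightarrow> x = x' \<and> (\<forall>k<p. slack k x *\<^sub>R w (j k) = slack k x *\<^sub>R w (j' k))"
    by auto
  also have "\<dots> \<longleftrightarrow> x = x' \<and> (\<forall>k<p. slack k x = 0 \<or> j k = j' k)"
    using scaleR_w_eq_iff assms by (intro conj_cong refl all_cong) blast
  finally show ?thesis .
qed

lemma lift_affine:
  obtains c L where "linear L" "inj L" "lift j = (\<lambda>x. c + L x)"
proof
  let ?L = "\<lambda>x. (x, \<chi> m. (- (a (blk m) \<bullet> x)) *\<^sub>R w (j (blk m))) :: (real^2) \<times> (real^'r^'p)"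
  show "linear ?L"
    by (rule linearI) (auto simp: vec_eq_iff inner_add_right algebra_simps)
  show "inj ?L" by (auto simp: inj_on_def)
  show "lift j = (\<lambda>x. lift j 0 + ?L x)"
    by (auto simp: lift_def slack_def vec_eq_iff fun_eq_iff algebra_simps)
qed

lemma lift_image_affine:
  obtains c L where "linear L" "inj L" "\<And>S. lift j ` S = (+) c ` L ` S" "\<And>x. lift j x = c + L x"
proof -
  obtain c L where "linear L" "inj L" "lift j = (\<lambda>x. c + L x)" by (rule lift_affine)
  then show ?thesis by (intro that[of L c]) (auto simp: image_image)
qed

lemma inj_lift: "inj (lift j)"
  by (rule inj_onI) (metis fst_lift)

lemma lift_face_of_iff: "lift j ` F face_of lift j ` S \<longleftrightarrow> F face_of S"
  by (rule lift_image_affine[of j]) (simp add: face_of_linear_image)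

lemma aff_dim_lift: "aff_dim (lift j ` S) = aff_dim S"
  by (rule lift_image_affine[of j]) (simp add: aff_dim_translation_eq)

lemma lift_polytope: "polytope S \<Longrightarrow> polytope (lift j ` S)"
  by (rule lift_image_affine[of j]) (simp add: polytope_translation_eq polytope_linear_image)

lemma lift_closed_segment: "lift j ` closed_segment x y = closed_segment (lift j x) (lift j y)"
  by (rule lift_image_affine[of j]) (simp add: closed_segment_linear_image closed_segment_translation)

lemma continuous_on_lift: "continuous_on S (lift j)"
  unfolding lift_def slack_def by (intro continuous_intros)

lemma lift_extreme_points: "{x. x extreme_point_of lift j ` S} = lift j ` {x. x extreme_point_of S}"
proof -
  have "x extreme_point_of lift j ` S \<longleftrightarrow> (\<exists>y. x = lift j y \<and> y extreme_point_of S)" for x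
  proof
    assume x: "x extreme_point_of lift j ` S"
    then obtain y where y: "x = lift j y" by (auto simp: extreme_point_of_def)
    have "lift j ` {y} face_of lift j ` S" using x by (simp add: y face_of_singleton)
    then show "\<exists>y. x = lift j y \<and> y extreme_point_of S"
      unfolding lift_face_of_iff face_of_singleton using y by auto
  next
    assume "\<exists>y. x = lift j y \<and> y extreme_point_of S"
    then obtain y where y: "x = lift j y" "y extreme_point_of S" by auto
    then have "lift j ` {y} face_of lift j ` S" by (simp only: lift_face_of_iff face_of_singleton)
    then show "x extreme_point_of lift j ` S" by (simp add: y(1) face_of_singleton)
  qed
  then show ?thesis by auto
qed

section \<open>The lifted polygons as faces of the wedge product\<close>

abbreviation W where "W \<equiv> wedge_product p q a b \<iota>"
abbreviation K where "K \<equiv> Sigma_complex p q a b \<iota>"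

text \<open>The normal vector of the facet hyperplane with indices \<open>k\<close> and
  \<open>l\<close> in the product space, so that the inequalities become half-spaces in the sense of
  the inner product.\<close>

definition nrm :: "nat \<Rightarrow> nat \<Rightarrow> (real^2) \<times> (real^'r^'p)" where
  "nrm k l = (a k, axis (\<iota> k) (b l))"

lemma nrm_inner: "nrm k l \<bullet> z = a k \<bullet> fst z + b l \<bullet> (snd z $ \<iota> k)"
  by (simp add: nrm_def inner_prod_def inner_axis')

lemma W_iff: "z \<in> W \<longleftrightarrow> (\<forall>k<p. \<forall>l<q. nrm k l \<bullet> z \<le> 1)"
  by (auto simp: wedge_product_def nrm_inner)

lemma facet_hyperplane_iff: "facet_hyperplane a b \<iota> k l = {z. nrm k l \<bullet> z = 1}"
  by (simp add: facet_hyperplane_def nrm_inner)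

lemma convex_W: "convex W"
proof -
  have "W = (\<Inter>k\<in>{..<p}. \<Inter>l\<in>{..<q}. {z. nrm k l \<bullet> z \<le> 1})"
    by (auto simp: W_iff)
  then show ?thesis by (simp add: convex_INT convex_halfspace_le)
qed

lemma nrm_lift:
  assumes "k < p" "l < q" "j k < q"
  shows "nrm k l \<bullet> lift j x = (if l = j k then 1 - slack k x * (1 - b l \<bullet> w l) else 1)"
  using assms b_w[of "j k" l] by (auto simp: nrm_inner slack_def algebra_simps)

text \<open>By \<open>w_unique\<close>, the equations with \<open>l \<noteq> j k\<close> determine
  block \<open>k\<close> from \<open>x\<close>, namely as \<open>slack k x\<close> times
  \<open>w (j k)\<close>. The one remaining inequality of block \<open>k\<close> then says that
  \<open>slack k x\<close> is nonnegative, since \<open>b (j k)\<close> is below 1 at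
  \<open>w (j k)\<close>.\<close>

lemma lift_C_eq:
  assumes j0: "\<forall>k<p. j k < q"
  shows "lift j ` C = {z \<in> W. \<forall>k<p. \<forall>l<q. l \<noteq> j k \<longrightarrow> nrm k l \<bullet> z = 1}"
proof (intro equalityI subsetI)
  note j = j0[rule_format]
  fix z assume "z \<in> lift j ` C"
  then show "z \<in> {z \<in> W. \<forall>k<p. \<forall>l<q. l \<noteq> j k \<longrightarrow> nrm k l \<bullet> z = 1}"
    using j b_w_less by (auto simp: W_iff nrm_lift C_iff less_imp_le)
next
  note j = j0[rule_format]
  fix z assume z: "z \<in> {z \<in> W. \<forall>k<p. \<forall>l<q. l \<noteq> j k \<longrightarrow> nrm k l \<bullet> z = 1}"
  have "snd z $ \<iota> k = slack k (fst z) *\<^sub>R w (j k)" if "k < p" for k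
  proof -
    have "snd z $ \<iota> k - slack k (fst z) *\<^sub>R w (j k) = 0"
      using z that j[OF that] b_w[OF j[OF that]]
      by (intro w_unique[of "j k"]) (auto simp: nrm_inner inner_diff_right slack_def algebra_simps)
    then show ?thesis by simp
  qed
  then have eq: "z = lift j (fst z)"
    by (auto simp: prod_eq_iff block_eq_iff)
  have "0 \<le> slack k (fst z)" if "k < p" for k
  proof -
    have "nrm k (j k) \<bullet> lift j (fst z) \<le> 1"
      using z that j W_iff eq by auto
    then show ?thesis
      using b_w_less[OF j[OF that]] that j by (auto simp: nrm_lift zero_le_mult_iff)
  qed
  then show "z \<in> lift j ` C" using eq by (auto simp: C_iff intro!: image_eqI)
qed

lemma lift_C_face:
  assumes j0: "\<forall>k<p. j k < q"
  shows "lift j ` C face_of W"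
proof -
  note j = j0[rule_format]
  define I where "I = {(k, l). k < p \<and> l < q \<and> l \<noteq> j k}"
  \<comment> \<open>\<open>face_of_Inter\<close> asks for a nonempty family; as q is at least 2,
    block 0 has an index different from \<open>j 0\<close>.\<close>
  have "(0, if j 0 = 0 then 1 else 0) \<in> I" using p3 q2 by (auto simp: I_def)
  then have ne: "I \<noteq> {}" by auto
  then have "(\<Inter>(k, l)\<in>I. W \<inter> {z. nrm k l \<bullet> z = 1}) face_of W"
    unfolding split_def
    by (intro face_of_Inter) (auto simp: I_def W_iff intro!: face_of_Int_supporting_hyperplane_le convex_W)
  also have "(\<Inter>(k, l)\<in>I. W \<inter> {z. nrm k l \<bullet> z = 1}) = lift j ` C"
    using ne unfolding lift_C_eq[OF j0] by (auto simp only: I_def)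
  finally show ?thesis .
qed

lemma ex_interior_point: obtains x where "x \<in> C" "\<And>k. k < p \<Longrightarrow> slack k x > 0"
proof -
  obtain x where x: "x \<in> C" "{k. k < p \<and> slack k x = 0} = {}"
    by (rule ex_point_with_zeros[of "{}"]) (auto simp: admissible_def)
  then show ?thesis
    using slack_nonneg[OF x(1)] by (intro that[of x]) (auto simp: less_le)
qed

lemma face_entry_lift_C:
  assumes j0: "\<forall>k<p. j k < q" and k: "k < p"
  shows "face_entry q a b \<iota> (lift j ` C) k = {..<q} - {j k}"
proof -
  note j = j0[rule_format]
  obtain x where x: "x \<in> C" "\<And>k. k < p \<Longrightarrow> slack k x > 0" using ex_interior_point by blast
  have "nrm k (j k) \<bullet> lift j x \<noteq> 1"
    using x(2)[OF k] b_w_less[OF j[OF k]] k j by (auto simp: nrm_lift)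
  then show ?thesis
    using x(1) k j by (auto simp: face_entry_def facet_hyperplane_iff nrm_lift image_subset_iff)
qed

text \<open>The prescribed equations put \<open>G\<close> inside the lifted polygon, so
  \<open>G\<close> is the lift of a face of \<open>C\<close>. A proper nonempty face lies on some
  edge \<open>k\<close>, which would add \<open>j k\<close> to the \<open>k\<close>-th entry; the
  empty face would have only full entries.\<close>

lemma face_entry_unique:
  assumes j0: "\<forall>k<p. j k < q" and G: "G face_of W"
    and entry: "\<And>k. k < p \<Longrightarrow> face_entry q a b \<iota> G k = {..<q} - {j k}"
  shows "G = lift j ` C"
proof -
  note j = j0[rule_format]
  have sub: "G \<subseteq> lift j ` C"
  proof
    fix z assume z: "z \<in> G"
    have "nrm k l \<bullet> z = 1" if "k < p" "l < q" "l \<noteq> j k" for k l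
    proof -
      have "l \<in> face_entry q a b \<iota> G k" using entry that by auto
      then show ?thesis using z by (auto simp: face_entry_def facet_hyperplane_iff)
    qed
    then show "z \<in> lift j ` C"
      unfolding lift_C_eq[OF j0] using face_of_imp_subset[OF G] z by auto
  qed
  have notin: "j k \<notin> face_entry q a b \<iota> G k" if "k < p" for k
    using entry[OF that] by auto
  define F where "F = {x \<in> C. lift j x \<in> G}"
  have GF: "G = lift j ` F" using sub by (auto simp: F_def)
  have "G face_of lift j ` C"
    by (rule face_of_subset[OF G sub face_of_imp_subset[OF lift_C_face[OF j0]]])
  then have "F face_of C" unfolding GF lift_face_of_iff .
  moreover have "F \<noteq> {}"
  proof
    assume "F = {}"
    then have "j 0 \<in> face_entry q a b \<iota> G 0"
      using j[of 0] p3 by (auto simp: GF face_entry_def)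
    then show False using notin[of 0] p3 by auto
  qed
  ultimately obtain N where N: "admissible N" "F = polygon_face N"
    using face_of_C_iff by metis
  have "N = {}"
  proof (rule ccontr)
    assume "N \<noteq> {}"
    then obtain k where k: "k \<in> N" "k < p" using admissible_subset[OF N(1)] by auto
    then have "j k \<in> face_entry q a b \<iota> G k"
      using j[OF k(2)] unfolding GF N(2)
      by (auto simp: face_entry_def facet_hyperplane_iff nrm_lift polygon_face_def)
    then show False using notin k by auto
  qed
  then show ?thesis by (simp add: GF N(2) polygon_face_simps)
qed

section \<open>Balanced vectors and the incidences of lifted faces\<close>

definition balanced :: "(nat \<Rightarrow> nat) \<Rightarrow> bool" where
  "balanced j \<longleftrightarrow> [(\<Sum>k<p. j k) = 0] (mod q) \<or> [(\<Sum>k<p. j k) = 1] (mod q)"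

text \<open>Members are total functions with arbitrary values from \<open>p\<close> on, so different
  ones may give the same polygon. Counting is therefore done with partial maps and not on
  \<open>J\<close>.\<close>

definition J :: "(nat \<Rightarrow> nat) set" where
  "J = {j. (\<forall>k<p. j k < q) \<and> balanced j}"

lemma J_less: "j \<in> J \<Longrightarrow> k < p \<Longrightarrow> j k < q"
  by (auto simp: J_def)

lemma Sigma_polygons_eq: "Sigma_polygons p q a b \<iota> = (\<lambda>j. lift j ` C) ` J"
proof (intro equalityI subsetI)
  fix G assume "G \<in> Sigma_polygons p q a b \<iota>"
  then obtain j where "G face_of W" "\<forall>k<p. j k < q \<and> face_entry q a b \<iota> G k = {..<q} - {j k}" "balanced j"
    by (auto simp: Sigma_polygons_def balanced_def)
  then show "G \<in> (\<lambda>j. lift j ` C) ` J"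
    using face_entry_unique[of j G] by (auto simp: J_def)
next
  fix G assume "G \<in> (\<lambda>j. lift j ` C) ` J"
  then obtain j where j: "j \<in> J" "G = lift j ` C" by auto
  then show "G \<in> Sigma_polygons p q a b \<iota>"
    using lift_C_face[of j] face_entry_lift_C[of j]
    by (auto simp: Sigma_polygons_def J_def balanced_def intro!: exI[of _ j])
qed

lemma K_eq: "K = {lift j ` polygon_face N | j N. j \<in> J \<and> admissible N}"
proof (intro equalityI subsetI)
  fix F assume "F \<in> K"
  then obtain j where j: "j \<in> J" "F face_of lift j ` C" "F \<noteq> {}"
    by (auto simp: Sigma_complex_def Sigma_polygons_eq)
  then obtain G where G: "F = lift j ` G" by (metis face_of_imp_subset subset_imageE)
  with j have "G face_of C \<and> G \<noteq> {}" by (auto simp: lift_face_of_iff)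
  then show "F \<in> {lift j ` polygon_face N | j N. j \<in> J \<and> admissible N}"
    unfolding face_of_C_iff using G j(1) by auto
next
  fix F assume "F \<in> {lift j ` polygon_face N | j N. j \<in> J \<and> admissible N}"
  then obtain j N where jN: "j \<in> J" "admissible N" "F = lift j ` polygon_face N" by auto
  then have "polygon_face N face_of C \<and> polygon_face N \<noteq> {}" by (subst face_of_C_iff) auto
  then have "F \<noteq> {}" "F face_of lift j ` C" using jN(3) by (auto simp: lift_face_of_iff)
  then show "F \<in> K"
    using jN(1) by (auto simp only: Sigma_complex_def Sigma_polygons_eq mem_Collect_eq)
qed

lemma Union_K: "\<Union>K = (\<Union>j\<in>J. lift j ` C)"
proof -
  have sub: "polygon_face N \<subseteq> C" for N by (auto simp: polygon_face_def)
  have "lift j ` C \<in> K" if "j \<in> J" for j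
    unfolding K_eq using that polygon_face_simps(1) by (auto simp: admissible_def)
  moreover have "F \<subseteq> (\<Union>j\<in>J. lift j ` C)" if "F \<in> K" for F
    using that sub unfolding K_eq by blast
  ultimately show ?thesis by blast
qed

text \<open>Tested at a point whose vanishing slacks are exactly \<open>N\<close>: its lift
  determines the entries outside \<open>N\<close> and forgets the others.\<close>

lemma face_subset_iff:
  assumes "j \<in> J" "j' \<in> J" "admissible N" "admissible N'"
  shows "lift j ` polygon_face N \<subseteq> lift j' ` polygon_face N' \<longleftrightarrow>
    N' \<subseteq> N \<and> (\<forall>k<p. k \<notin> N \<longrightarrow> j k = j' k)"
proof
  assume sub: "lift j ` polygon_face N \<subseteq> lift j' ` polygon_face N'"
  obtain x where x: "x \<in> C" "{k. k < p \<and> slack k x = 0} = N"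
    by (rule ex_point_with_zeros[OF assms(3)])
  have "x \<in> polygon_face N" using x by (auto simp: polygon_face_def)
  then obtain x' where "x' \<in> polygon_face N'" "lift j x = lift j' x'" using sub by auto
  then have "x \<in> polygon_face N'" "\<forall>k<p. slack k x = 0 \<or> j k = j' k"
    using lift_eq_iff[of x j j' x'] assms by (auto simp: J_less)
  then show "N' \<subseteq> N \<and> (\<forall>k<p. k \<notin> N \<longrightarrow> j k = j' k)"
    using x(2) admissible_subset[OF assms(4)] by (auto simp: polygon_face_def)
next
  assume *: "N' \<subseteq> N \<and> (\<forall>k<p. k \<notin> N \<longrightarrow> j k = j' k)"
  have "lift j x \<in> lift j' ` polygon_face N'" if "x \<in> polygon_face N" for x
  proof -
    have "lift j x = lift j' x"
      using * that assms by (subst lift_eq_iff) (auto simp: J_less polygon_face_def)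
    then show ?thesis using * that by (auto simp: polygon_face_def)
  qed
  then show "lift j ` polygon_face N \<subseteq> lift j' ` polygon_face N'" by auto
qed

lemma balanced_int: "balanced j \<longleftrightarrow>
    [(\<Sum>k<p. int (j k)) = 0] (mod int q) \<or> [(\<Sum>k<p. int (j k)) = 1] (mod int q)"
  using cong_int_iff[of "\<Sum>k<p. j k" 0 q] cong_int_iff[of "\<Sum>k<p. j k" 1 q]
  by (simp add: balanced_def)

text \<open>One free entry brings the sum to any residue. Hence a partial vector of digits with at
  least one gap extends to a balanced one, which is why the sum condition does not restrict edges
  and vertices.\<close>

lemma ex_adjusted_value:
  assumes "k < p"
  obtains r where "r < q" "[(\<Sum>i<p. int ((j(k := r)) i)) = c] (mod int q)"
proof -
  define d where "d = c - (\<Sum>i\<in>{..<p} - {k}. int (j i))"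
  show ?thesis
  proof (rule that[of "nat (d mod int q)"])
    show "nat (d mod int q) < q" using q2 by (simp add: nat_less_iff)
    have "(\<Sum>i<p. int ((j(k := nat (d mod int q))) i)) =
        d mod int q + (\<Sum>i\<in>{..<p} - {k}. int ((j(k := nat (d mod int q))) i))"
      using assms q2 by (simp add: sum.remove[of "{..<p}" k])
    also have "(\<Sum>i\<in>{..<p} - {k}. int ((j(k := nat (d mod int q))) i)) = c - d"
      by (simp add: d_def)
    also have "[d mod int q + (c - d) = d + (c - d)] (mod int q)"
      by (intro cong_add) (auto simp: cong_def)
    finally show "[(\<Sum>i<p. int ((j(k := nat (d mod int q))) i)) = c] (mod int q)" by simp
  qed
qed

end


section \<open>Counting faces\<close>

lemma card_maps_on:
  assumes "finite D"
  shows "finite {h :: 'a \<Rightarrow> nat option. dom h = D \<and> ran h \<subseteq> {..<q}}"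
    and "card {h :: 'a \<Rightarrow> nat option. dom h = D \<and> ran h \<subseteq> {..<q}} = q ^ card D"
proof -
  let ?f = "\<lambda>j k. if k \<in> D then Some (j k) else None"
  let ?g = "\<lambda>h. restrict (the \<circ> h) D"
  let ?M = "{h :: 'a \<Rightarrow> nat option. dom h = D \<and> ran h \<subseteq> {..<q}}"
  have "bij_betw ?f (PiE D (\<lambda>_. {..<q})) ?M"
  proof (rule bij_betw_byWitness[where f' = ?g])
    show "\<forall>j\<in>PiE D (\<lambda>_. {..<q}). ?g (?f j) = j"
      by (auto simp: fun_eq_iff PiE_def extensional_def)
    show "\<forall>h\<in>?M. ?f (?g h) = h"
      by (auto simp: fun_eq_iff domIff)
    show "?f ` PiE D (\<lambda>_. {..<q}) \<subseteq> ?M"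
      by (auto simp: ran_def PiE_def split: if_splits)
    show "?g ` ?M \<subseteq> PiE D (\<lambda>_. {..<q})"
      by (force simp: ran_def)
  qed
  from bij_betw_finite[OF this] bij_betw_same_card[OF this]
  show "finite ?M" "card ?M = q ^ card D"
    using assms by (simp_all add: finite_PiE card_PiE)
qed

context wedge_surface
begin

text \<open>A face of \<open>K\<close> is encoded by a partial map: the index \<open>k\<close> is mapped to the element of
  \<open>[q] - H\<^sub>k\<close>, and it is left undefined if \<open>H\<^sub>k = [q]\<close>.\<close>

definition lab :: "(nat \<Rightarrow> nat) \<Rightarrow> nat set \<Rightarrow> nat \<Rightarrow> nat option" where
  "lab j N k = (if k < p \<and> k \<notin> N then Some (j k) else None)"

definition labels :: "(nat \<Rightarrow> nat option) set" where
  "labels = {lab j N | j N. j \<in> J \<and> admissible N}"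

definition cell :: "(nat \<Rightarrow> nat option) \<Rightarrow> ((real^2) \<times> (real^'r^'p)) set" where
  "cell h = lift (the \<circ> h) ` polygon_face ({..<p} - dom h)"

definition corank :: "(nat \<Rightarrow> nat option) \<Rightarrow> nat" where
  "corank h = card ({..<p} - dom h)"

definition labels_on :: "nat set \<Rightarrow> (nat \<Rightarrow> nat option) set" where
  "labels_on D = {h. dom h = D \<and> ran h \<subseteq> {..<q}}"

lemma finite_labels_on: "finite D \<Longrightarrow> finite (labels_on D)"
  and card_labels_on: "finite D \<Longrightarrow> card (labels_on D) = q ^ card D"
  unfolding labels_on_def by (fact card_maps_on)+

lemma undefined_lab: "admissible N \<Longrightarrow> {..<p} - dom (lab j N) = N"
  using admissible_subset[of N] by (auto simp: lab_def dom_def)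

lemma cell_lab:
  assumes "j \<in> J" "admissible N"
  shows "cell (lab j N) = lift j ` polygon_face N"
  unfolding cell_def undefined_lab[OF assms(2)]
proof (rule image_cong[OF refl])
  fix x assume "x \<in> polygon_face N"
  then show "lift (the \<circ> lab j N) x = lift j x"
    using assms by (subst lift_eq_iff) (auto simp: lab_def polygon_face_def J_less)
qed

lemma lab_le_iff:
  assumes "admissible N" "admissible N'"
  shows "lab j N \<subseteq>\<^sub>m lab j' N' \<longleftrightarrow> N' \<subseteq> N \<and> (\<forall>k<p. k \<notin> N \<longrightarrow> j k = j' k)"
  using admissible_subset[OF assms(2)]
  by (auto simp: map_le_def lab_def dom_def split: if_splits)

text \<open>With forgotten entries as undefined values, the two conditions of
  \<open>face_subset_iff\<close> merge into extension of partial maps.\<close>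

lemma cell_subset_iff:
  assumes "h \<in> labels" "h' \<in> labels"
  shows "cell h \<subseteq> cell h' \<longleftrightarrow> h \<subseteq>\<^sub>m h'"
proof -
  obtain j N j' N' where "h = lab j N" "j \<in> J" "admissible N" "h' = lab j' N'" "j' \<in> J" "admissible N'"
    using assms by (auto simp: labels_def)
  then show ?thesis by (simp only: cell_lab face_subset_iff lab_le_iff)
qed

lemma inj_on_cell: "inj_on cell labels"
  by (rule inj_onI) (metis cell_subset_iff map_le_antisym order_refl)

lemma K_labels: "K = cell ` labels"
proof -
  have "K = {cell (lab j N) | j N. j \<in> J \<and> admissible N}"
    unfolding K_eq using cell_lab by force
  also have "\<dots> = cell ` labels"
    unfolding labels_def by blast
  finally show ?thesis .
qed

lemma aff_dim_cell: "h \<in> labels \<Longrightarrow> aff_dim (cell h) = 2 - int (corank h)"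
  by (auto simp: labels_def cell_lab aff_dim_lift aff_dim_polygon_face corank_def undefined_lab)

lemma cells_K: "cells d K = cell ` {h \<in> labels. corank h + d = 2}"
  unfolding cells_def K_labels using aff_dim_cell by force

lemma f_number_K: "f_number d K = card {h \<in> labels. corank h + d = 2}"
  unfolding f_number_def cells_K
  by (rule card_image) (rule inj_on_subset[OF inj_on_cell], auto)

text \<open>Prepares the counting: the sum condition survives only for \<open>N = {}\<close>, since
  otherwise an entry in the gap absorbs it.\<close>

lemma labels_iff: "h \<in> labels \<longleftrightarrow>
    (\<exists>N. admissible N \<and> h \<in> labels_on ({..<p} - N) \<and> (N = {} \<longrightarrow> balanced (the \<circ> h)))"
proof
  assume "h \<in> labels"
  then obtain j N where jN: "j \<in> J" "admissible N" "h = lab j N" by (auto simp: labels_def)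
  have "h \<in> labels_on ({..<p} - N)"
    using jN J_less admissible_subset[of N]
    by (auto simp: labels_on_def lab_def dom_def ran_def split: if_splits)
  moreover have "balanced (the \<circ> h)" if "N = {}"
  proof -
    have "(\<Sum>k<p. (the \<circ> h) k) = (\<Sum>k<p. j k)" by (rule sum.cong) (auto simp: jN(3) lab_def that)
    then show ?thesis using jN(1) by (simp add: J_def balanced_def)
  qed
  ultimately show "\<exists>N. admissible N \<and> h \<in> labels_on ({..<p} - N) \<and> (N = {} \<longrightarrow> balanced (the \<circ> h))"
    using jN(2) by blast
next
  assume "\<exists>N. admissible N \<and> h \<in> labels_on ({..<p} - N) \<and> (N = {} \<longrightarrow> balanced (the \<circ> h))"
  then obtain N where N: "admissible N" "dom h = {..<p} - N" "ran h \<subseteq> {..<q}"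
    "N = {} \<Longrightarrow> balanced (the \<circ> h)"
    by (auto simp: labels_on_def)
  have less: "the (h k) < q" if "k < p" "k \<notin> N" for k
  proof -
    have "k \<in> dom h" using that N by auto
    then show ?thesis using N(3) by (auto simp: ran_def)
  qed
  have None: "h k = None" if "\<not> k < p \<or> k \<in> N" for k
    using that N(2) by (auto simp: domIff[symmetric])
  have Some: "h k = Some (the (h k))" if "k < p" "k \<notin> N" for k
    using that N(2) by (metis DiffI domD lessThan_iff option.sel)
  have "\<exists>j\<in>J. \<forall>k<p. k \<notin> N \<longrightarrow> j k = the (h k)"
  proof (cases "N = {}")
    case True
    then show ?thesis using N(4) less by (intro bexI[of _ "the \<circ> h"]) (auto simp: J_def)
  next
    case False
    then obtain m where m: "m \<in> N" "m < p" using admissible_subset[OF N(1)] by auto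
    \<comment> \<open>Entries in the gap are free: 0 is a provisional value, and the one at
      \<open>m\<close> is then corrected to make the sum 0 modulo q.\<close>
    define j0 where "j0 k = (if k \<in> N then 0 else the (h k))" for k
    obtain r where r: "r < q" "[(\<Sum>i<p. int ((j0(m := r)) i)) = 0] (mod int q)"
      by (rule ex_adjusted_value[OF m(2)])
    have "j0(m := r) \<in> J"
      unfolding J_def balanced_int using r less q2 by (auto simp: j0_def)
    then show ?thesis using m(1) by (intro bexI[of _ "j0(m := r)"]) (auto simp: j0_def)
  qed
  then obtain j where j: "j \<in> J" "\<forall>k<p. k \<notin> N \<longrightarrow> j k = the (h k)" by auto
  have "h = lab j N"
    using j(2) None Some by (auto simp: fun_eq_iff lab_def)
  then show "h \<in> labels" using j(1) N(1) by (auto simp: labels_def)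
qed

lemma finite_labels: "finite labels"
proof (rule finite_subset)
  show "labels \<subseteq> (\<Union>N\<in>Pow {..<p}. labels_on ({..<p} - N))"
  proof
    fix h assume "h \<in> labels"
    then obtain N where "admissible N" "h \<in> labels_on ({..<p} - N)" by (auto simp: labels_iff)
    then show "h \<in> (\<Union>N\<in>Pow {..<p}. labels_on ({..<p} - N))" using admissible_subset by auto
  qed
qed (auto intro: finite_labels_on)

lemma corank_labels_on: "h \<in> labels_on ({..<p} - N) \<Longrightarrow> N \<subseteq> {..<p} \<Longrightarrow> corank h = card N"
proof -
  assume "h \<in> labels_on ({..<p} - N)" "N \<subseteq> {..<p}"
  then have "{..<p} - dom h = N" by (auto simp: labels_on_def)
  then show ?thesis by (simp add: corank_def)
qed

lemma labels_corank_0: "{h \<in> labels. corank h = 0} = {h \<in> labels_on {..<p}. balanced (the \<circ> h)}"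
proof -
  have "h \<in> labels \<and> corank h = 0 \<longleftrightarrow> h \<in> labels_on {..<p} \<and> balanced (the \<circ> h)" for h
  proof
    assume h: "h \<in> labels \<and> corank h = 0"
    then obtain N where N: "admissible N" "h \<in> labels_on ({..<p} - N)" "N = {} \<longrightarrow> balanced (the \<circ> h)"
      by (auto simp: labels_iff)
    then have "card N = 0" using h corank_labels_on admissible_subset by metis
    then have "N = {}" using admissible_finite N(1) by auto
    then show "h \<in> labels_on {..<p} \<and> balanced (the \<circ> h)" using N by simp
  next
    assume h: "h \<in> labels_on {..<p} \<and> balanced (the \<circ> h)"
    then have "corank h = 0" using corank_labels_on[of h "{}"] by simp
    then show "h \<in> labels \<and> corank h = 0"
      unfolding labels_iff using h by (auto simp: admissible_def intro!: exI[of _ "{}"])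
  qed
  then show ?thesis by auto
qed

lemma labels_corank_1: "{h \<in> labels. corank h = 1} = (\<Union>i<p. labels_on ({..<p} - {i}))"
proof -
  have "\<exists>i<p. N = {i}" if "admissible N" "card N = 1" for N
    using that by (cases rule: admissible_cases) auto
  moreover have "admissible {i}" if "i < p" for i using that by (auto simp: admissible_def)
  ultimately show ?thesis
    using corank_labels_on admissible_subset
    by (fastforce simp: labels_iff)
qed

lemma labels_corank_2: "{h \<in> labels. corank h = 2} = (\<Union>i<p. labels_on ({..<p} - {i, nxt i}))"
proof -
  have "\<exists>i<p. N = {i, nxt i}" if "admissible N" "card N = 2" for N
    using that by (cases rule: admissible_cases) auto
  moreover have "admissible {i, nxt i}" "card {i, nxt i} = 2" if "i < p" for i
    using that by (auto simp: admissible_def)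
  ultimately show ?thesis
    using corank_labels_on admissible_subset
    by (fastforce simp: labels_iff)
qed

section \<open>The f-vector\<close>

lemma labels_on_disjoint: "D \<noteq> D' \<Longrightarrow> labels_on D \<inter> labels_on D' = {}"
  by (auto simp: labels_on_def)

lemma corner_inj: "i < p \<Longrightarrow> i' < p \<Longrightarrow> {i, nxt i} = {i', nxt i'} \<Longrightarrow> i = i'"
  by (metis doubleton_eq_iff nxt_nxt_neq(1))

lemma f_number_1: "f_number 1 K = p * q ^ (p - 1)"
proof -
  have "f_number 1 K = card (\<Union>i<p. labels_on ({..<p} - {i}))"
    using labels_corank_1 by (simp add: f_number_K)
  also have "\<dots> = (\<Sum>i<p. card (labels_on ({..<p} - {i})))"
  proof (rule card_UN_disjoint)
    show "\<forall>i\<in>{..<p}. \<forall>i'\<in>{..<p}. i \<noteq> i' \<longrightarrow> labels_on ({..<p} - {i}) \<inter> labels_on ({..<p} - {i'}) = {}"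
      by (intro ballI impI labels_on_disjoint) auto
  qed (auto intro: finite_labels_on)
  also have "\<dots> = (\<Sum>i<p. q ^ (p - 1))"
    by (intro sum.cong refl) (simp add: card_labels_on)
  finally show ?thesis by simp
qed

lemma f_number_0: "f_number 0 K = p * q ^ (p - 2)"
proof -
  have "f_number 0 K = card (\<Union>i<p. labels_on ({..<p} - {i, nxt i}))"
    using labels_corank_2 by (simp add: f_number_K)
  also have "\<dots> = (\<Sum>i<p. card (labels_on ({..<p} - {i, nxt i})))"
  proof (rule card_UN_disjoint)
    have "{..<p} - {i, nxt i} \<noteq> {..<p} - {i', nxt i'}" if "i < p" "i' < p" "i \<noteq> i'" for i i'
    proof
      assume "{..<p} - {i, nxt i} = {..<p} - {i', nxt i'}"
      then have "{..<p} - ({..<p} - {i, nxt i}) = {..<p} - ({..<p} - {i', nxt i'})" by simp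
      then have "{i, nxt i} = {i', nxt i'}" using that by (simp add: Diff_Diff_Int Int_absorb1)
      then show False using corner_inj that by blast
    qed
    then show "\<forall>i\<in>{..<p}. \<forall>i'\<in>{..<p}. i \<noteq> i' \<longrightarrow>
        labels_on ({..<p} - {i, nxt i}) \<inter> labels_on ({..<p} - {i', nxt i'}) = {}"
      by (intro ballI impI labels_on_disjoint) auto
  qed (auto intro: finite_labels_on)
  also have "\<dots> = (\<Sum>i<p. q ^ (p - 2))"
    by (intro sum.cong refl) (simp add: card_labels_on card_Diff_subset numeral_2_eq_2)
  finally show ?thesis by simp
qed

text \<open>Dropping the entry at 0 is a bijection onto the unrestricted vectors on the other
  \<open>p - 1\<close> indices, since the prescribed residue determines the dropped entry.\<close>

lemma card_labels_with_sum:
  "card {h \<in> labels_on {..<p}. [(\<Sum>k<p. int (the (h k))) = s] (mod int q)} = q ^ (p - 1)"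
proof -
  let ?B = "{h \<in> labels_on {..<p}. [(\<Sum>k<p. int (the (h k))) = s] (mod int q)}"
  have p0: "0 < p" using p3 by simp
  have "bij_betw (\<lambda>h. h(0 := None)) ?B (labels_on ({..<p} - {0}))"
  proof (rule bij_betw_imageI)
    show "inj_on (\<lambda>h. h(0 := None)) ?B"
    proof (rule inj_onI)
      fix g h assume g: "g \<in> ?B" and h: "h \<in> ?B" and eq: "g(0 := None) = h(0 := None)"
      have eq': "g k = h k" if "k \<noteq> 0" for k using fun_cong[OF eq, of k] that by simp
      have "[(\<Sum>k<p. int (the (g k))) = (\<Sum>k<p. int (the (h k)))] (mod int q)"
        using g h cong_trans cong_sym by blast
      moreover have "(\<Sum>k\<in>{..<p} - {0}. int (the (g k))) = (\<Sum>k\<in>{..<p} - {0}. int (the (h k)))"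
        by (intro sum.cong) (auto simp: eq')
      ultimately have "[int (the (g 0)) = int (the (h 0))] (mod int q)"
        using p0 by (simp add: sum.remove[of "{..<p}" 0] cong_add_rcancel)
      moreover obtain x y where xy: "g 0 = Some x" "h 0 = Some y" "x < q" "y < q"
      proof -
        have "0 \<in> dom g" "0 \<in> dom h" using g h p0 by (auto simp: labels_on_def)
        then obtain x y where "g 0 = Some x" "h 0 = Some y" by auto
        moreover from this have "x < q" "y < q" using g h by (auto simp: labels_on_def ran_def)
        ultimately show ?thesis using that by blast
      qed
      ultimately have "g 0 = h 0" by (simp add: cong_int_iff cong_def)
      with eq' show "g = h" by (metis ext)
    qed
    show "(\<lambda>h. h(0 := None)) ` ?B = labels_on ({..<p} - {0})"
    proof (intro equalityI subsetI)
      fix g assume "g \<in> (\<lambda>h. h(0 := None)) ` ?B"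
      then obtain h where h: "g = h(0 := None)" "dom h = {..<p}" "ran h \<subseteq> {..<q}"
        by (auto simp: labels_on_def)
      moreover have "ran g \<subseteq> ran h" by (auto simp: h(1) ran_def)
      ultimately show "g \<in> labels_on ({..<p} - {0})" by (simp add: labels_on_def)
    next
      fix g assume g: "g \<in> labels_on ({..<p} - {0})"
      obtain r where r: "r < q" "[(\<Sum>i<p. int (((the \<circ> g)(0 := r)) i)) = s] (mod int q)"
        by (rule ex_adjusted_value[OF p0])
      have "(\<Sum>i<p. int (((the \<circ> g)(0 := r)) i)) = (\<Sum>k<p. int (the ((g(0 \<mapsto> r)) k)))"
        by (intro sum.cong) auto
      then have "g(0 \<mapsto> r) \<in> ?B"
        using g r p0 by (auto simp: labels_on_def ran_def)
      moreover have "g 0 = None" using g by (auto simp: labels_on_def)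
      then have "g = (g(0 \<mapsto> r))(0 := None)" by (auto simp: fun_eq_iff)
      ultimately show "g \<in> (\<lambda>h. h(0 := None)) ` ?B" by blast
    qed
  qed
  from bij_betw_same_card[OF this] show ?thesis using p0 by (simp add: card_labels_on)
qed

lemma f_number_2: "f_number 2 K = 2 * q ^ (p - 1)"
proof -
  let ?B = "\<lambda>s. {h \<in> labels_on {..<p}. [(\<Sum>k<p. int (the (h k))) = s] (mod int q)}"
  have "f_number 2 K = card (?B 0 \<union> ?B 1)"
    using labels_corank_0 by (auto simp: f_number_K balanced_int intro: arg_cong[of _ _ card])
  also have "\<dots> = card (?B 0) + card (?B 1)"
  proof (rule card_Un_disjoint)
    have "\<not> [0 = 1] (mod int q)" using q2 by (simp add: cong_def)
    then show "?B 0 \<inter> ?B 1 = {}" using cong_trans cong_sym by blast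
  qed (auto simp: finite_labels_on)
  finally show ?thesis by (simp add: card_labels_with_sum)
qed

section \<open>The polygons and the degrees of the vertices\<close>

lemma cells_2_eq: "cells 2 K = (\<lambda>j. lift j ` C) ` J"
proof (intro equalityI subsetI)
  fix P assume "P \<in> cells 2 K"
  then obtain j N where jN: "j \<in> J" "admissible N" "P = lift j ` polygon_face N" "aff_dim P = 2"
    by (auto simp: cells_def K_eq)
  then have "card N = 0" using aff_dim_polygon_face[of N] by (simp add: aff_dim_lift)
  then have "N = {}" using admissible_finite[OF jN(2)] by simp
  then show "P \<in> (\<lambda>j. lift j ` C) ` J" using jN by (auto simp: polygon_face_simps)
next
  fix P assume "P \<in> (\<lambda>j. lift j ` C) ` J"
  then obtain j where "j \<in> J" "P = lift j ` C" by auto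
  moreover have "admissible {}" by (simp add: admissible_def)
  ultimately show "P \<in> cells 2 K"
    unfolding cells_def K_eq using polygon_face_simps(1) by (auto simp: aff_dim_lift aff_dim_C)
qed

lemma convex_polygon_lift: "convex_polygon p (lift j ` C)"
  unfolding convex_polygon_def lift_extreme_points
  using card_image[OF inj_on_subset[OF inj_lift subset_UNIV]]
  by (simp add: lift_polytope polytope_C aff_dim_lift aff_dim_C card_vertices)

text \<open>An edge through the vertex fills one of its two gaps, \<open>i\<close> or
  \<open>nxt i\<close>. Labels of edges carry no sum condition, so all q digits occur.\<close>

lemma labels_above_vertex:
  assumes i: "i < p" and h: "h \<in> labels_on ({..<p} - {i, nxt i})"
  shows "{g \<in> labels. corank g = 1 \<and> h \<subseteq>\<^sub>m g} =
    (\<lambda>r. h(i \<mapsto> r)) ` {..<q} \<union> (\<lambda>r. h(nxt i \<mapsto> r)) ` {..<q}" (is "?L = ?R")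
proof (intro equalityI subsetI)
  fix g assume "g \<in> ?L"
  then have "g \<in> (\<Union>i<p. labels_on ({..<p} - {i}))" and hg: "h \<subseteq>\<^sub>m g"
    unfolding labels_corank_1[symmetric] by auto
  then obtain m where m: "m < p" "g \<in> labels_on ({..<p} - {m})" by auto
  have dom: "dom h = {..<p} - {i, nxt i}" "dom g = {..<p} - {m}"
    using h m by (auto simp: labels_on_def)
  have "m = i \<or> m = nxt i"
    using map_le_implies_dom_le[OF hg] m(1) unfolding dom by auto
  then obtain n where n: "n < p" "n \<noteq> m" "{i, nxt i} = {m, n}" "n = i \<or> n = nxt i"
    using i by (metis insert_commute nxt_less nxt_neq(1))
  then have "n \<in> dom g" unfolding dom by auto
  then obtain r where r: "g n = Some r" by auto
  then have "r < q" using m(2) by (auto simp: labels_on_def ran_def)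
  moreover have "g = h(n \<mapsto> r)"
  proof
    fix k show "g k = (h(n \<mapsto> r)) k"
    proof (cases "k \<in> dom h")
      case True
      then have "k \<noteq> n" using n unfolding dom by auto
      then show ?thesis using hg True by (simp add: map_le_def)
    next
      case False
      then have "k = n \<or> k \<notin> dom g" unfolding dom n(3) by auto
      then show ?thesis using False r by (auto simp: domIff)
    qed
  qed
  ultimately show "g \<in> ?R" using n(4) by blast
next
  fix g assume "g \<in> ?R"
  then obtain n r where n: "n = i \<or> n = nxt i" "r < q" "g = h(n \<mapsto> r)" by auto
  define m where "m = (if n = i then nxt i else i)"
  have mn: "m < p" "n < p" "n \<noteq> m" "{i, nxt i} = {m, n}"
    using n(1) i by (auto simp: m_def)
  have dom: "dom h = {..<p} - {m, n}" "ran h \<subseteq> {..<q}" using h mn(4) by (auto simp: labels_on_def)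
  have "g \<in> labels_on ({..<p} - {m})"
    using mn dom n unfolding labels_on_def by (auto simp: ran_def split: if_splits)
  then have "g \<in> {g \<in> labels. corank g = 1}" unfolding labels_corank_1 using mn(1) by auto
  moreover have "h \<subseteq>\<^sub>m g" using dom mn by (auto simp: n(3) map_le_def)
  ultimately show "g \<in> ?L" by auto
qed

lemma vertex_degree:
  assumes "x \<in> cells 0 K"
  shows "card {e \<in> cells 1 K. x \<subseteq> e} = 2 * q"
proof -
  obtain h where h: "h \<in> labels" "corank h = 2" "x = cell h"
    using assms by (auto simp: cells_K)
  then have "h \<in> (\<Union>i<p. labels_on ({..<p} - {i, nxt i}))"
    unfolding labels_corank_2[symmetric] by auto
  then obtain i where i: "i < p" "h \<in> labels_on ({..<p} - {i, nxt i})" by auto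
  let ?R = "(\<lambda>r. h(i \<mapsto> r)) ` {..<q} \<union> (\<lambda>r. h(nxt i \<mapsto> r)) ` {..<q}"
  have undef: "h i = None" "h (nxt i) = None" using i by (auto simp: labels_on_def domIff[symmetric])
  have "{e \<in> cells 1 K. x \<subseteq> e} = cell ` {g \<in> labels. corank g = 1 \<and> h \<subseteq>\<^sub>m g}"
    using cell_subset_iff[OF h(1)] by (auto simp: cells_K h(3))
  also have "card \<dots> = card {g \<in> labels. corank g = 1 \<and> h \<subseteq>\<^sub>m g}"
    by (rule card_image) (rule inj_on_subset[OF inj_on_cell], auto)
  also have "\<dots> = card ?R"
    by (simp only: labels_above_vertex[OF i])
  also have "\<dots> = card ((\<lambda>r. h(i \<mapsto> r)) ` {..<q}) + card ((\<lambda>r. h(nxt i \<mapsto> r)) ` {..<q})"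
  proof (rule card_Un_disjoint)
    have "h(i \<mapsto> r) \<noteq> h(nxt i \<mapsto> s)" for r s
      using undef i by (metis fun_upd_other fun_upd_same nxt_neq(1) option.distinct(1))
    then show "(\<lambda>r. h(i \<mapsto> r)) ` {..<q} \<inter> (\<lambda>r. h(nxt i \<mapsto> r)) ` {..<q} = {}" by auto
  qed auto
  also have "\<dots> = 2 * q"
  proof -
    have "card ((\<lambda>r. h(m \<mapsto> r)) ` {..<q}) = q" for m
      by (subst card_image) (auto simp: inj_on_def dest!: fun_cong[of _ _ m])
    then show ?thesis by (simp only: mult_2)
  qed
  finally show ?thesis .
qed

lemma has_type_K: "has_type K p (2 * q)"
  unfolding has_type_def cells_2_eq using convex_polygon_lift vertex_degree by auto

end


section \<open>Orientability and connectedness\<close>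

lemma polygon_orientation_converse:
  assumes "polygon_orientation P D"
  shows "polygon_orientation P (D\<inverse>)"
proof -
  obtain n c where n: "n \<ge> 3" and c: "bij_betw c {..<n} {v. v extreme_point_of P}"
    and e: "\<forall>i<n. closed_segment (c i) (c (Suc i mod n)) edge_of P"
    and D: "D = (\<lambda>i. (c i, c (Suc i mod n))) ` {..<n}"
    using assms by (auto simp: polygon_orientation_def)
  define c' where "c' i = c (n - 1 - i)" for i
  have rev: "bij_betw (\<lambda>i. n - 1 - i) {..<n} {..<n}"
    by (rule bij_betw_byWitness[where f' = "\<lambda>i. n - 1 - i"]) auto
  \<comment> \<open>Reversal turns successors into predecessors; only \<open>Suc i = n\<close> wraps
    around.\<close>
  have prev: "Suc (n - 1 - Suc i mod n) mod n = n - 1 - i" if "i < n" for i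
    using that n by (cases "Suc i = n") auto
  have c'_suc: "(c' i, c' (Suc i mod n)) = (c (Suc m mod n), c m)"
    if "i < n" "m = n - 1 - Suc i mod n" for i m
    using prev that by (simp add: c'_def)
  have m_less: "n - 1 - Suc i mod n < n" for i using n by simp
  have "(\<lambda>i. (c' i, c' (Suc i mod n))) ` {..<n} = D\<inverse>"
  proof (intro equalityI subsetI)
    fix d assume "d \<in> (\<lambda>i. (c' i, c' (Suc i mod n))) ` {..<n}"
    then show "d \<in> D\<inverse>" using c'_suc m_less unfolding D by fastforce
  next
    fix d assume "d \<in> D\<inverse>"
    then obtain m where m: "m < n" "d = (c (Suc m mod n), c m)" unfolding D by auto
    define i where "i = n - 1 - Suc m mod n"
    have i: "i < n" using n by (simp add: i_def)
    have "n - 1 - Suc i mod n = m"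
      using prev[OF m(1)] m(1) by (simp add: i_def)
    then show "d \<in> (\<lambda>i. (c' i, c' (Suc i mod n))) ` {..<n}"
      using c'_suc[OF i, of m] i m(2) by (metis (no_types, lifting) image_eqI lessThan_iff)
  qed
  moreover have "bij_betw c' {..<n} {v. v extreme_point_of P}"
    using bij_betw_trans[OF rev c] by (simp add: c'_def[abs_def] comp_def)
  moreover have "closed_segment (c' i) (c' (Suc i mod n)) edge_of P" if "i < n" for i
    using c'_suc[OF that refl] e m_less[of i] by (metis closed_segment_commute prod.inject)
  ultimately show ?thesis
    unfolding polygon_orientation_def using n by (intro exI[of _ n] exI[of _ c']) auto
qed

context wedge_surface
begin

definition darts :: "(nat \<Rightarrow> nat) \<Rightarrow> (((real^2) \<times> (real^'r^'p)) \<times> ((real^2) \<times> (real^'r^'p))) set" where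
  "darts j = (\<lambda>i. (lift j (vert i), lift j (vert (nxt i)))) ` {..<p}"

lemma orientation_darts: "polygon_orientation (lift j ` C) (darts j)"
  unfolding polygon_orientation_def
proof (intro exI[of _ p] exI[of _ "\<lambda>i. lift j (vert i)"] conjI allI impI)
  have "bij_betw vert {..<p} {x. x extreme_point_of C}"
    unfolding vertices using vert_inj by (auto simp: bij_betw_def inj_on_def)
  moreover have "bij_betw (lift j) {x. x extreme_point_of C} {x. x extreme_point_of lift j ` C}"
    unfolding lift_extreme_points using inj_on_subset[OF inj_lift subset_UNIV] by (auto simp: bij_betw_def)
  ultimately show "bij_betw (\<lambda>i. lift j (vert i)) {..<p} {x. x extreme_point_of lift j ` C}"
    using bij_betw_trans by (fastforce simp: comp_def)
  fix i assume i: "i < p"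
  have "closed_segment (lift j (vert i)) (lift j (vert (Suc i mod p))) = lift j ` E (nxt i)"
    using E_nxt[OF i] by (simp add: lift_closed_segment nxt_def)
  then show "closed_segment (lift j (vert i)) (lift j (vert (Suc i mod p))) edge_of lift j ` C"
    using E_face[of "nxt i"] by (simp add: edge_of_def lift_face_of_iff aff_dim_lift aff_dim_E)
qed (use p3 in \<open>auto simp: darts_def nxt_def\<close>)

text \<open>The two vertices span edge \<open>nxt i\<close>, and no other edge contains both. So
  every other slack is nonzero at one of them, and the lift of that vertex determines the
  entry.\<close>

lemma lift_common_edge:
  assumes "j \<in> J" "j' \<in> J" "i < p"
    and "lift j (vert i) = lift j' (vert i)" "lift j (vert (nxt i)) = lift j' (vert (nxt i))"
    and "k < p" "k \<noteq> nxt i"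
  shows "j k = j' k"
proof -
  have "slack k (vert i) = 0 \<or> j k = j' k" "slack k (vert (nxt i)) = 0 \<or> j k = j' k"
    using assms lift_eq_iff[of "vert i" j j' "vert i"] lift_eq_iff[of "vert (nxt i)" j j' "vert (nxt i)"]
    by (auto simp: J_less)
  moreover have "\<not> (slack k (vert i) = 0 \<and> slack k (vert (nxt i)) = 0)"
    using slack_vert[of i k] slack_vert[of "nxt i" k] assms by auto
  ultimately show ?thesis by blast
qed

text \<open>Polygons with coordinate sum \<open>0\<close> are oriented like \<open>C\<close>, those with sum \<open>1\<close> oppositely;
  neighbouring polygons have different coordinate sums.\<close>

lemma orientable_K: "orientable K"
proof -
  define s where "s j = (\<Sum>k<p. int (j k))" for j :: "nat \<Rightarrow> nat"
  define D where "D j = (if [s j = 0] (mod int q) then darts j else (darts j)\<inverse>)" for j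
  define lbl where "lbl P = (SOME j. j \<in> J \<and> P = lift j ` C)" for P
  have lbl: "lbl P \<in> J \<and> P = lift (lbl P) ` C" if "P \<in> cells 2 K" for P
  proof -
    have "\<exists>j. j \<in> J \<and> P = lift j ` C" using that unfolding cells_2_eq by auto
    then show ?thesis unfolding lbl_def by (rule someI_ex)
  qed
  have orient: "polygon_orientation (lift j ` C) (D j)" for j
    using orientation_darts polygon_orientation_converse by (auto simp: D_def)
  \<comment> \<open>A common dart means a common edge, so the vectors agree except at one index;
    equal residues of the sums force agreement there too.\<close>
  have same: "lift j ` C = lift j' ` C"
    if j: "j \<in> J" "j' \<in> J" and meet: "darts j \<inter> darts j' \<noteq> {}"
      and s: "[s j = 0] (mod int q) \<longleftrightarrow> [s j' = 0] (mod int q)" for j j'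
  proof -
    obtain i i' where i: "i < p" "i' < p" "lift j (vert i) = lift j' (vert i')"
      "lift j (vert (nxt i)) = lift j' (vert (nxt i'))"
    proof -
      obtain d where "d \<in> darts j" "d \<in> darts j'" using meet by blast
      then obtain i i' where "i < p" "i' < p" "d = (lift j (vert i), lift j (vert (nxt i)))"
        "d = (lift j' (vert i'), lift j' (vert (nxt i')))"
        unfolding darts_def by blast
      then show ?thesis using that by simp
    qed
    have "vert i = vert i'" using arg_cong[OF i(3), of fst] by simp
    then have ii: "i' = i" using vert_inj i by auto
    have agree: "j k = j' k" if "k < p" "k \<noteq> nxt i" for k
      using lift_common_edge[OF j i(1)] i(3,4) that unfolding ii by blast
    have "[s j = s j'] (mod int q)"
      using s j unfolding J_def balanced_int s_def mem_Collect_eq by (metis cong_sym cong_trans)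
    moreover have "(\<Sum>k\<in>{..<p} - {nxt i}. int (j k)) = (\<Sum>k\<in>{..<p} - {nxt i}. int (j' k))"
      by (intro sum.cong) (auto simp: agree)
    ultimately have "[int (j (nxt i)) = int (j' (nxt i))] (mod int q)"
      unfolding s_def by (simp add: sum.remove[of "{..<p}" "nxt i"] cong_add_rcancel)
    then have "j (nxt i) = j' (nxt i)"
      using J_less j by (simp add: cong_int_iff cong_def)
    then have "\<forall>k<p. j k = j' k" using agree by metis
    then have "lift j x = lift j' x" for x
      using j by (subst lift_eq_iff) (auto simp: J_less)
    then show ?thesis by simp
  qed
  \<comment> \<open>Projecting to \<open>C\<close> gives \<open>i = nxt i'\<close> and
    \<open>i' = nxt i\<close>, impossible for p at least 3. So polygons of different orientation
    classes never share a directed edge.\<close>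
  have opp: "darts j \<inter> (darts j')\<inverse> = {}" for j j'
  proof (rule ccontr)
    assume "darts j \<inter> (darts j')\<inverse> \<noteq> {}"
    then obtain i i' where i: "i < p" "i' < p" "lift j (vert i) = lift j' (vert (nxt i'))"
      "lift j (vert (nxt i)) = lift j' (vert i')"
    proof -
      obtain y z where "(y, z) \<in> darts j" "(z, y) \<in> darts j'"
        using \<open>darts j \<inter> (darts j')\<inverse> \<noteq> {}\<close> by blast
      then obtain i i' where "i < p" "i' < p" "(y, z) = (lift j (vert i), lift j (vert (nxt i)))"
        "(z, y) = (lift j' (vert i'), lift j' (vert (nxt i')))"
        unfolding darts_def by blast
      then show ?thesis using that by simp
    qed
    have "vert i = vert (nxt i')" "vert (nxt i) = vert i'"
      using arg_cong[OF i(3), of fst] arg_cong[OF i(4), of fst] by simp_all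
    then have "i = nxt i'" "nxt i = i'" using vert_inj i by auto
    then show False using i by auto
  qed
  show ?thesis
    unfolding orientable_def
  proof (intro exI[of _ "\<lambda>P. D (lbl P)"] conjI ballI impI)
    fix P assume "P \<in> cells 2 K"
    then show "polygon_orientation P (D (lbl P))"
      using orient lbl by metis
  next
    fix P Q assume PQ: "P \<in> cells 2 K" "Q \<in> cells 2 K" "P \<noteq> Q"
    then have "\<not> (([s (lbl P) = 0] (mod int q) \<longleftrightarrow> [s (lbl Q) = 0] (mod int q)) \<and>
        darts (lbl P) \<inter> darts (lbl Q) \<noteq> {})"
      using same[of "lbl P" "lbl Q"] lbl by metis
    then show "D (lbl P) \<inter> D (lbl Q) = {}"
      using opp[of "lbl P" "lbl Q"] opp[of "lbl Q" "lbl P"]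
      by (auto simp: D_def split: if_splits)
  qed
qed

section \<open>Connectedness and compactness\<close>

lemma connected_component_lift:
  assumes "j \<in> J" "x \<in> C" "y \<in> C"
  shows "connected_component (\<Union>K) (lift j x) (lift j y)"
proof -
  have "connected (lift j ` C)"
    by (intro connected_continuous_image continuous_on_lift convex_connected convex_C)
  then show ?thesis
    unfolding connected_component_def using assms by (intro exI[of _ "lift j ` C"]) (auto simp: Union_K)
qed

text \<open>Both polygons contain the same lift of \<open>vert i\<close>, where the entries
  \<open>i\<close> and \<open>nxt i\<close> are multiplied by 0.\<close>

lemma connected_component_lift_adjacent:
  assumes "j \<in> J" "j' \<in> J" "i < p" "x \<in> C" "y \<in> C"
    and "\<And>k. k < p \<Longrightarrow> k \<noteq> i \<Longrightarrow> k \<noteq> nxt i \<Longrightarrow> j k = j' k"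
  shows "connected_component (\<Union>K) (lift j x) (lift j' y)"
proof -
  have "lift j (vert i) = lift j' (vert i)"
    using assms by (subst lift_eq_iff) (auto simp: J_less slack_vert)
  then show ?thesis
    using connected_component_trans[OF connected_component_lift[OF assms(1,4) vert_C[OF assms(3)]]]
      connected_component_lift[OF assms(2) vert_C[OF assms(3)] assms(5)]
    by simp
qed

text \<open>Induction on the number \<open>m\<close> of leading entries that may differ. The last of
  these is set to its target, and the entry just before it is adjusted to keep the sum balanced; the
  two indices are consecutive, so the new polygon shares a vertex with the old one.\<close>

lemma connected_component_lift_all:
  assumes "j \<in> J" "j' \<in> J" "x \<in> C" "y \<in> C" "\<And>k. m \<le> k \<Longrightarrow> k < p \<Longrightarrow> j k = j' k"
  shows "connected_component (\<Union>K) (lift j x) (lift j' y)"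
  using assms
proof (induction m arbitrary: j x)
  case 0
  then show ?case
    using p3 by (intro connected_component_lift_adjacent[of j j' 0]) auto
next
  case (Suc m)
  consider "p \<le> m" | "m = 0" | i where "m = Suc i" "m < p"
    by (metis leI not0_implies_Suc)
  then show ?case
  proof cases
    case 1
    then show ?thesis using Suc by simp
  next
    \<comment> \<open>Only entry 0 can differ here, so the two polygons already meet above
      \<open>vert 0\<close>.\<close>
    case 2
    then show ?thesis
      using p3 Suc.prems by (intro connected_component_lift_adjacent[of j j' 0]) auto
  next
    case 3
    then have i: "i < p" "nxt i = m" by (auto simp: nxt_def)
    obtain r where r: "r < q" "[(\<Sum>k<p. int (((j(m := j' m))(i := r)) k)) = 0] (mod int q)"
      by (rule ex_adjusted_value[OF i(1)])
    let ?j = "(j(m := j' m))(i := r)"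
    have jJ: "?j \<in> J"
      unfolding J_def balanced_int using r Suc.prems(1,2) 3 by (auto simp: J_less)
    have "connected_component (\<Union>K) (lift j x) (lift ?j x)"
      using Suc.prems i jJ by (intro connected_component_lift_adjacent[of _ _ i]) auto
    moreover have "connected_component (\<Union>K) (lift ?j x) (lift j' y)"
    proof (rule Suc.IH[OF jJ Suc.prems(2-4)])
      fix k assume k: "m \<le> k" "k < p"
      then have "k \<noteq> i" using 3 by simp
      then show "?j k = j' k" using Suc.prems(5)[of k] k by (cases "k = m") auto
    qed
    ultimately show ?thesis by (rule connected_component_trans)
  qed
qed

lemma connected_Union_K: "connected (\<Union>K)"
  unfolding connected_iff_connected_component
proof (intro ballI)
  fix z z' assume "z \<in> \<Union>K" "z' \<in> \<Union>K"
  then obtain j x j' x' where "j \<in> J" "x \<in> C" "z = lift j x" "j' \<in> J" "x' \<in> C" "z' = lift j' x'"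
    unfolding Union_K by auto
  then show "connected_component (\<Union>K) z z'"
    using connected_component_lift_all[of j j' x x' p] by auto
qed

lemma compact_Union_K: "compact (\<Union>K)"
proof (rule compact_Union)
  show "finite K" unfolding K_labels using finite_labels by simp
  fix F assume "F \<in> K"
  then obtain j where "F face_of lift j ` C" by (auto simp: Sigma_complex_def Sigma_polygons_eq)
  then show "compact F"
    using face_of_polytope_polytope lift_polytope[OF polytope_C] polytope_imp_compact by blast
qed

end


section \<open>Charts at the vertices\<close>

context wedge_surface
begin

text \<open>The open star of a vertex is mapped piecewise linearly to the plane: the polygon given by
  the entries \<open>m\<close>, \<open>r\<close> at the two edges through the vertex becomes the cone over the rays \<open>u m\<close> and \<open>u' r\<close>.\<close>

lemma star_chart:
  assumes j0: "j0 \<in> J" and i: "i < p"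
    and x0: "x0 \<in> C" "\<And>k. k < p \<Longrightarrow> k \<noteq> i \<Longrightarrow> k \<noteq> nxt i \<Longrightarrow> slack k x0 \<noteq> 0"
  shows "\<exists>U V :: (real^2) set. openin (top_of_set (\<Union>K)) U \<and> lift j0 x0 \<in> U \<and> open V \<and> U homeomorphic V"
proof -
  define n where "n = nxt i"
  have n: "n < p" "n \<noteq> i" "i \<noteq> n" using i by (auto simp: n_def)
  define I where "I = {..<p} - {i, n}"
  \<comment> \<open>Minus the sum of the fixed entries: a vector agreeing with \<open>j0\<close> on
    \<open>I\<close> is balanced iff its two free digits add up to \<open>c\<close> or
    \<open>c + 1\<close>, the pattern of the alternating fan.\<close>
  define c where "c = - (\<Sum>k\<in>I. int (j0 k))"
  define compat where "compat m r \<longleftrightarrow>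
    [int m + int r = c] (mod int q) \<or> [int m + int r = c + 1] (mod int q)" for m r
  define g where "g m r = j0(i := m, n := r)" for m r
  obtain u u' :: "nat \<Rightarrow> real^2" and f f' :: "nat \<Rightarrow> real^2 \<Rightarrow> real"
    where cont_f: "\<And>m. continuous_on UNIV (f m)" "\<And>m. continuous_on UNIV (f' m)"
    and cones: "\<And>z. \<exists>m r s t. m < q \<and> r < q \<and> 0 \<le> s \<and> 0 \<le> t \<and> compat m r \<and>
          z = s *\<^sub>R u m + t *\<^sub>R u' r"
    and f: "\<And>m r s t k. \<lbrakk>m < q; r < q; k < q; 0 \<le> s; 0 \<le> t; compat m r\<rbrakk> \<Longrightarrow>
          f k (s *\<^sub>R u m + t *\<^sub>R u' r) = (if k = m then s else 0) \<and>
          f' k (s *\<^sub>R u m + t *\<^sub>R u' r) = (if k = r then t else 0)"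
    unfolding compat_def by (rule ex_alternating_fan[OF q2, of c]) blast
  obtain e e' where e: "a i \<bullet> e = - 1" "a n \<bullet> e = 0" "a i \<bullet> e' = 0" "a n \<bullet> e' = - 1"
    and zero: "\<And>d. a i \<bullet> d = 0 \<Longrightarrow> a n \<bullet> d = 0 \<Longrightarrow> d = 0"
    unfolding n_def by (rule corner_directions[OF i]) blast
  \<comment> \<open>The point of the plane with slacks \<open>s\<close> and \<open>t\<close> at the
    edges \<open>i\<close> and \<open>n\<close>; membership in \<open>C\<close> is imposed
    separately.\<close>
  define X where "X s t = vert i + s *\<^sub>R e + t *\<^sub>R e'" for s t
  have slack_v: "slack i (vert i) = 0" "slack n (vert i) = 0"
    using slack_vert i n by (auto simp: n_def)
  have slack_X: "slack i (X s t) = s" "slack n (X s t) = t" for s t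
    using slack_v e by (auto simp: slack_def X_def inner_add_right)
  have X_slack: "X (slack i x) (slack n x) = x" for x
  proof -
    have "x - X (slack i x) (slack n x) = 0"
      by (rule zero; use slack_X[of "slack i x" "slack n x"] in \<open>simp add: slack_def inner_diff_right\<close>)
    then show ?thesis by simp
  qed
  have sum_split: "(\<Sum>k<p. int (h k)) = int (h i) + int (h n) + (\<Sum>k\<in>I. int (h k))" for h :: "nat \<Rightarrow> nat"
  proof -
    have "{..<p} = insert i (insert n I)" "i \<notin> insert n I" "n \<notin> I" "finite I"
      using i n by (auto simp: I_def)
    then show ?thesis by simp
  qed
  have balanced_g: "balanced h \<longleftrightarrow> compat (h i) (h n)" if "\<And>k. k \<in> I \<Longrightarrow> h k = j0 k" for h
  proof -
    have eq: "(\<Sum>k<p. int (h k)) = int (h i) + int (h n) - c"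
      unfolding sum_split using that by (simp add: c_def)
    show ?thesis
      unfolding balanced_int compat_def cong_iff_dvd_diff eq by (simp add: algebra_simps)
  qed
  have g_J: "g m r \<in> J" if "m < q" "r < q" "compat m r" for m r
  proof -
    have "balanced (g m r)"
      by (subst balanced_g) (use that n in \<open>auto simp: g_def I_def\<close>)
    then show ?thesis using that J_less[OF j0] by (auto simp: J_def g_def)
  qed
  \<comment> \<open>Parametrises the open star: a polygon by its two free digits, and a point of
    \<open>C\<close> off all edges except \<open>i\<close> and \<open>n\<close>.\<close>
  define P where "P m r x \<longleftrightarrow> m < q \<and> r < q \<and> compat m r \<and> x \<in> C \<and> (\<forall>k\<in>I. 0 < slack k x)" for m r x
  \<comment> \<open>At each point of the plane at most one of the functions \<open>f k\<close> is
    nonzero, likewise for \<open>f' k\<close>. So these sums read off the two slacks, and in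
    \<open>G\<close> the same functions select the vertices \<open>w k\<close> for the blocks
    \<open>i\<close> and \<open>n\<close>.\<close>
  define S where "S z = (\<Sum>k<q. f k z)" for z
  define T where "T z = (\<Sum>k<q. f' k z)" for z
  define Y where "Y z = X (S z) (T z)" for z
  define G :: "real^2 \<Rightarrow> (real^2) \<times> (real^'r^'p)" where "G z = (Y z,
     \<chi> m. if blk m = i then \<Sum>k<q. f k z *\<^sub>R w k else if blk m = n then \<Sum>k<q. f' k z *\<^sub>R w k
       else slack (blk m) (Y z) *\<^sub>R w (j0 (blk m)))" for z
  \<comment> \<open>On a lifted polygon block \<open>k\<close> is \<open>slack k x\<close> times
    \<open>w (j k)\<close>, so this affine expression gives \<open>slack k x\<close> for
    \<open>l = j k\<close> and 0 for the other digits. It does not refer to the polygon, so \<Phi>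
    is continuous as it stands.\<close>
  define \<beta> where "\<beta> k l y = (slack k (fst y) - b l \<bullet> (snd y $ \<iota> k)) / (1 - b l \<bullet> w l)"
    for k l and y :: "(real^2) \<times> (real^'r^'p)"
  define \<Phi> where "\<Phi> y = (\<Sum>l<q. \<beta> i l y *\<^sub>R u l) + (\<Sum>l<q. \<beta> n l y *\<^sub>R u' l)" for y
  \<comment> \<open>Excluding the wrong multiples of \<open>w l\<close> pins the entries on
    \<open>I\<close> to those of \<open>j0\<close>, and does so by open conditions.\<close>
  define U where "U = {y \<in> \<Union>K. \<forall>k\<in>I. 0 < slack k (fst y) \<and>
    (\<forall>l\<in>{..<q} - {j0 k}. snd y $ \<iota> k \<noteq> slack k (fst y) *\<^sub>R w l)}"
  define V where "V = {z. \<forall>k\<in>I. 0 < slack k (Y z)}"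
  have cont_Y: "continuous_on UNIV Y"
    unfolding Y_def X_def S_def T_def by (intro continuous_intros cont_f)
  have open_V: "open V"
  proof -
    have "V = (\<Inter>k\<in>I. {z. 0 < slack k (Y z)})" by (auto simp: V_def)
    moreover have "open {z. 0 < slack k (Y z)}" for k
      unfolding slack_def by (intro open_Collect_less continuous_intros cont_Y)
    ultimately show ?thesis by (simp add: open_INT I_def)
  qed
  have open_U: "openin (top_of_set (\<Union>K)) U"
  proof -
    define O1 where "O1 k = {y :: (real^2) \<times> (real^'r^'p). 0 < slack k (fst y)}" for k
    define O2 where "O2 k l = {y :: (real^2) \<times> (real^'r^'p). snd y $ \<iota> k \<noteq> slack k (fst y) *\<^sub>R w l}" for k l
    have "open (O1 k)" "open (O2 k l)" for k l
      unfolding O1_def O2_def slack_def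
      by (intro open_Collect_less open_Collect_neq continuous_intros)+
    then have o: "open (\<Inter>k\<in>I. O1 k \<inter> (\<Inter>l\<in>{..<q} - {j0 k}. O2 k l))"
      unfolding I_def by (intro open_INT open_Int ballI) auto
    have U: "U = \<Union>K \<inter> (\<Inter>k\<in>I. O1 k \<inter> (\<Inter>l\<in>{..<q} - {j0 k}. O2 k l))"
      unfolding U_def O1_def O2_def by blast
    show ?thesis unfolding U by (rule openin_open_Int[OF o])
  qed
  have g_less: "g m r k < q" if "P m r x" "k < p" for m r x k
    using g_J[of m r] J_less that by (auto simp: P_def)
  have g_I: "g m r k = j0 k" if "k \<in> I" for m r k using that by (auto simp: g_def I_def)
  have U_I: "lift (g m r) x \<in> U" if P: "P m r x" for m r x
  proof -
    have "snd (lift (g m r) x) $ \<iota> k \<noteq> slack k x *\<^sub>R w l" if "k \<in> I" "l < q" "l \<noteq> j0 k" for k l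
    proof -
      have "k < p" "0 < slack k x" using that P by (auto simp: I_def P_def)
      then show ?thesis
        using that J_less[OF j0] by (simp add: g_I scaleR_w_eq_iff del: scaleR_cancel_left)
    qed
    then show ?thesis
      using P g_J unfolding U_def Union_K by (auto simp: P_def)
  qed
  have U_D: "\<exists>m r x. P m r x \<and> y = lift (g m r) x" if "y \<in> U" for y
  proof -
    obtain h x where h: "h \<in> J" "x \<in> C" "y = lift h x"
      using \<open>y \<in> U\<close> unfolding U_def Union_K by auto
    have pos: "0 < slack k x" if "k \<in> I" for k using \<open>y \<in> U\<close> that by (auto simp: U_def h(3))
    have h_I: "h k = j0 k" if "k \<in> I" for k
    proof (rule ccontr)
      assume "h k \<noteq> j0 k"
      moreover have "k < p" using that by (auto simp: I_def)
      ultimately have "snd y $ \<iota> k \<noteq> slack k (fst y) *\<^sub>R w (h k)"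
        using \<open>y \<in> U\<close> that J_less[OF h(1)] unfolding U_def by blast
      then show False using \<open>k < p\<close> by (simp add: h(3))
    qed
    define h' where "h' = g (h i) (h n)"
    have "h k = h' k" if "k < p" for k
      using h_I that by (auto simp: h'_def g_def I_def)
    then have "y = lift (g (h i) (h n)) x"
      unfolding h'_def[symmetric] h(3) lift_def by simp
    moreover have "P (h i) (h n) x"
      using h pos balanced_g[OF h_I] i n by (auto simp: P_def J_def)
    ultimately show ?thesis by blast
  qed
  \<comment> \<open>The position in the fan of the point above \<open>x\<close> in the polygon with
    free digits \<open>m\<close> and \<open>r\<close>. Both \<Phi> and \<open>G\<close> are
    evaluated through it, which shows them mutually inverse.\<close>
  define \<zeta> where "\<zeta> m r x = slack i x *\<^sub>R u m + slack n x *\<^sub>R u' r" for m r x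
  have fz: "f k (\<zeta> m r x) = (if k = m then slack i x else 0)" "f' k (\<zeta> m r x) = (if k = r then slack n x else 0)"
    if "P m r x" "k < q" for m r x k
    using f[of m r k "slack i x" "slack n x"] that slack_nonneg i n by (auto simp: P_def \<zeta>_def)
  have Y_\<zeta>: "Y (\<zeta> m r x) = x" if "P m r x" for m r x
    using that fz[OF that] by (simp add: Y_def S_def T_def X_slack P_def)
  have V_I: "\<zeta> m r x \<in> V" if "P m r x" for m r x
    using that by (simp add: V_def Y_\<zeta> P_def)
  have V_D: "\<exists>m r x. P m r x \<and> z = \<zeta> m r x" if "z \<in> V" for z
  proof -
    obtain m r s t where z: "m < q" "r < q" "0 \<le> s" "0 \<le> t" "compat m r" "z = s *\<^sub>R u m + t *\<^sub>R u' r"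
      using cones by blast
    have "Y z = X s t"
      using f[OF z(1,2) _ z(3,4,5)] z(1,2) by (simp add: Y_def S_def T_def z(6))
    then have "0 < slack k (X s t)" if "k \<in> I" for k using \<open>z \<in> V\<close> that by (auto simp: V_def)
    moreover from this have "X s t \<in> C"
      using z slack_X unfolding C_iff I_def by (metis DiffI insertE lessThan_iff less_imp_le singletonD)
    ultimately have "P m r (X s t)" using z by (auto simp: P_def)
    then show ?thesis using z by (intro exI[of _ m] exI[of _ r] exI[of _ "X s t"]) (auto simp: \<zeta>_def slack_X)
  qed
  have \<beta>_lift: "\<beta> k l (lift h x) = (if l = h k then slack k x else 0)" if "k < p" "l < q" "h k < q" for k l h x
    using that b_w[of "h k" l] b_w_less[of l] by (auto simp: \<beta>_def field_simps)
  have \<Phi>_lift: "\<Phi> (lift (g m r) x) = \<zeta> m r x" if "P m r x" for m r x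
  proof -
    have mr: "m < q" "r < q" using that by (auto simp: P_def)
    have gi: "g m r i = m" "g m r n = r" using n by (auto simp: g_def)
    have "(\<Sum>l<q. \<beta> i l (lift (g m r) x) *\<^sub>R u l) = (\<Sum>l<q. if l = m then slack i x *\<^sub>R u l else 0)"
      "(\<Sum>l<q. \<beta> n l (lift (g m r) x) *\<^sub>R u' l) = (\<Sum>l<q. if l = r then slack n x *\<^sub>R u' l else 0)"
      by (rule sum.cong[OF refl], use i n mr in \<open>simp add: \<beta>_lift gi\<close>)+
    then show ?thesis using mr by (simp add: \<Phi>_def \<zeta>_def)
  qed
  have G_\<zeta>: "G (\<zeta> m r x) = lift (g m r) x" if "P m r x" for m r x
  proof -
    have mr: "m < q" "r < q" using that by (auto simp: P_def)
    have "(\<Sum>k<q. f k (\<zeta> m r x) *\<^sub>R w k) = (\<Sum>k<q. if k = m then slack i x *\<^sub>R w k else 0)"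
      "(\<Sum>k<q. f' k (\<zeta> m r x) *\<^sub>R w k) = (\<Sum>k<q. if k = r then slack n x *\<^sub>R w k else 0)"
      by (rule sum.cong[OF refl], use fz[OF that] in simp)+
    then show ?thesis
      using mr n by (auto simp: G_def Y_\<zeta>[OF that] lift_def vec_eq_iff g_def)
  qed
  have "homeomorphism U V \<Phi> G"
  proof (rule homeomorphismI)
    show "continuous_on U \<Phi>"
      unfolding \<Phi>_def \<beta>_def slack_def divide_inverse by (intro continuous_intros)
    have "continuous_on V Y" using cont_Y continuous_on_subset by blast
    moreover have "continuous_on V (f k)" "continuous_on V (f' k)" for k
      using cont_f continuous_on_subset by blast+
    ultimately have comp: "continuous_on V (\<lambda>z. if blk m = i then \<Sum>k<q. f k z *\<^sub>R w k
        else if blk m = n then \<Sum>k<q. f' k z *\<^sub>R w k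
        else slack (blk m) (Y z) *\<^sub>R w (j0 (blk m)))" for m
      unfolding slack_def by (cases "blk m = i"; cases "blk m = n"; simp; intro continuous_intros)
    show "continuous_on V G"
      unfolding G_def using \<open>continuous_on V Y\<close> comp by (intro continuous_on_Pair continuous_on_vec_lambda)
    show "\<Phi> ` U \<subseteq> V" using U_D V_I \<Phi>_lift by (metis image_subsetI)
    show "G ` V \<subseteq> U" using V_D U_I G_\<zeta> by (metis image_subsetI)
    show "G (\<Phi> y) = y" if "y \<in> U" for y using U_D[OF that] \<Phi>_lift G_\<zeta> by metis
    show "\<Phi> (G z) = z" if "z \<in> V" for z using V_D[OF that] \<Phi>_lift G_\<zeta> by metis
  qed
  moreover have "lift j0 x0 \<in> U"
  proof -
    have "g (j0 i) (j0 n) = j0" by (auto simp: g_def)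
    moreover have "P (j0 i) (j0 n) x0"
      using j0 x0 i n balanced_g[of j0] slack_nonneg[OF x0(1)]
      by (auto simp: P_def J_def I_def n_def less_le)
    ultimately show ?thesis using U_I[of "j0 i" "j0 n" x0] by simp
  qed
  ultimately show ?thesis
    using open_U open_V unfolding homeomorphic_def by blast
qed

text \<open>The zero slacks of a point all belong to one corner, so every point lies in the open
  star of a vertex and the charts there suffice. For a point above the interior of \<open>C\<close>
  any corner will do.\<close>

lemma closed_2_manifold_K: "closed_2_manifold (\<Union>K)"
  unfolding closed_2_manifold_def
proof (intro conjI ballI)
  fix z assume "z \<in> \<Union>K"
  then obtain j x where jx: "j \<in> J" "x \<in> C" "z = lift j x" unfolding Union_K by auto
  have "\<exists>i<p. {k. k < p \<and> slack k x = 0} \<subseteq> {i, nxt i}"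
    using admissible_zeros[OF jx(2)]
  proof (cases rule: admissible_cases)
    case empty
    have "0 < p" using p3 by simp
    then show ?thesis using empty by blast
  qed blast+
  then obtain i where "i < p" "\<And>k. k < p \<Longrightarrow> k \<noteq> i \<Longrightarrow> k \<noteq> nxt i \<Longrightarrow> slack k x \<noteq> 0"
    by blast
  then show "\<exists>U. \<exists>V::(real^2) set. openin (top_of_set (\<Union>K)) U \<and> z \<in> U \<and> open V \<and> U homeomorphic V"
    unfolding jx(3) using star_chart[OF jx(1) _ jx(2)] by blast
qed (rule compact_Union_K)

end


section \<open>Flag transitivity\<close>

context wedge_surface
begin

definition adj :: "nat \<Rightarrow> nat \<Rightarrow> bool" where
  "adj i l \<longleftrightarrow> i < p \<and> l < p \<and> (l = nxt i \<or> i = nxt l)"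

lemma eq_nxt_iff: "i < p \<Longrightarrow> l < p \<Longrightarrow> l = nxt i \<longleftrightarrow> [int l = int i + 1] (mod int p)"
  using cong_int_iff[of l "Suc i" p] by (simp add: nxt_def cong_def add.commute)

text \<open>Written modulo \<open>p\<close> with a sign, adjacency is visibly compatible with
  rotations and reflections of the indices.\<close>

lemma adj_int: "adj i l \<longleftrightarrow> i < p \<and> l < p \<and> (\<exists>e\<in>{1, -1}. [int l = int i + e] (mod int p))"
proof -
  have "i = nxt l \<longleftrightarrow> [int l = int i - 1] (mod int p)" if "i < p" "l < p"
  proof -
    have "int l - (int i - 1) = - (int i - (int l + 1))" by simp
    then show ?thesis unfolding eq_nxt_iff[OF that(2,1)] cong_iff_dvd_diff by (metis dvd_minus_iff)
  qed
  then show ?thesis unfolding adj_def using eq_nxt_iff by auto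
qed

lemma admissible_iff_adj: "admissible N \<longleftrightarrow> N = {} \<or> (\<exists>i<p. N = {i}) \<or> (\<exists>i l. adj i l \<and> N = {i, l})"
  unfolding admissible_def adj_def by (metis insert_commute nxt_less)

text \<open>The relabelling acts on partial maps, where it preserves and reflects extension. Hence
  it is injective, and surjective because there are only finitely many labels; invariance of
  \<open>J\<close> is thus asked in one direction only.\<close>

lemma relabelling_automorphism:
  assumes \<sigma>: "bij_betw \<sigma> {..<p} {..<p}" "\<And>N. admissible N \<Longrightarrow> admissible {k. k < p \<and> \<sigma> k \<in> N}"
    and \<pi>: "\<And>k. k < p \<Longrightarrow> inj_on (\<pi> k) {..<q}" "\<And>j. j \<in> J \<Longrightarrow> (\<lambda>k. \<pi> k (j (\<sigma> k))) \<in> J"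
  obtains \<phi> where "complex_automorphism K \<phi>"
    and "\<And>j N. j \<in> J \<Longrightarrow> admissible N \<Longrightarrow>
      \<phi> (lift j ` polygon_face N) = lift (\<lambda>k. \<pi> k (j (\<sigma> k))) ` polygon_face {k. k < p \<and> \<sigma> k \<in> N}"
proof -
  define \<psi> where "\<psi> h k = (if k < p then map_option (\<pi> k) (h (\<sigma> k)) else None)"
    for h :: "nat \<Rightarrow> nat option" and k
  have \<sigma>_less: "\<sigma> k < p" if "k < p" for k using bij_betwE[OF \<sigma>(1)] that by auto
  have \<psi>_lab: "\<psi> (lab j N) = lab (\<lambda>k. \<pi> k (j (\<sigma> k))) {k. k < p \<and> \<sigma> k \<in> N}" for j N
    using \<sigma>_less by (auto simp: \<psi>_def lab_def fun_eq_iff)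
  have \<psi>_labels: "\<psi> h \<in> labels" if "h \<in> labels" for h
    using that \<sigma>(2) \<pi>(2) \<psi>_lab unfolding labels_def by blast
  have \<psi>_le: "\<psi> g \<subseteq>\<^sub>m \<psi> h \<longleftrightarrow> g \<subseteq>\<^sub>m h" if gh: "g \<in> labels" "h \<in> labels" for g h
  proof -
    obtain j N j' N' where g: "j \<in> J" "admissible N" "g = lab j N"
      and h: "j' \<in> J" "admissible N'" "h = lab j' N'"
      using gh by (auto simp: labels_def)
    have \<pi>_eq: "\<pi> k (j (\<sigma> k)) = \<pi> k (j' (\<sigma> k)) \<longleftrightarrow> j (\<sigma> k) = j' (\<sigma> k)" if "k < p" for k
      using inj_on_eq_iff[OF \<pi>(1)[OF that]] J_less g h \<sigma>_less that by auto
    have surj: "(\<forall>k<p. P (\<sigma> k)) \<longleftrightarrow> (\<forall>k<p. P k)" for P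
      using \<sigma>(1) unfolding bij_betw_def by (metis imageE imageI lessThan_iff)
    have sub: "N' \<subseteq> N \<longleftrightarrow> (\<forall>k<p. k \<in> N' \<longrightarrow> k \<in> N)"
      using admissible_subset[OF h(2)] by auto
    have "\<psi> g \<subseteq>\<^sub>m \<psi> h \<longleftrightarrow> (\<forall>k<p. \<sigma> k \<in> N' \<longrightarrow> \<sigma> k \<in> N) \<and> (\<forall>k<p. \<sigma> k \<notin> N \<longrightarrow> j (\<sigma> k) = j' (\<sigma> k))"
      unfolding g h \<psi>_lab lab_le_iff[OF \<sigma>(2)[OF g(2)] \<sigma>(2)[OF h(2)]] using \<pi>_eq by auto
    also have "\<dots> \<longleftrightarrow> (\<forall>k<p. k \<in> N' \<longrightarrow> k \<in> N) \<and> (\<forall>k<p. k \<notin> N \<longrightarrow> j k = j' k)"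
      by (intro conj_cong surj)
    also have "\<dots> \<longleftrightarrow> g \<subseteq>\<^sub>m h"
      unfolding g h lab_le_iff[OF g(2) h(2)] sub ..
    finally show ?thesis .
  qed
  have "inj_on \<psi> labels"
    by (rule inj_onI) (metis \<psi>_le map_le_antisym map_le_refl)
  moreover have "\<psi> ` labels \<subseteq> labels" using \<psi>_labels by auto
  ultimately have \<psi>_bij: "bij_betw \<psi> labels labels"
    using endo_inj_surj[OF finite_labels] by (simp add: bij_betw_def)
  have cell_bij: "bij_betw cell labels K"
    by (simp add: bij_betw_def inj_on_cell K_labels)
  define \<phi> where "\<phi> = cell \<circ> (\<psi> \<circ> inv_into labels cell)"
  have \<phi>_cell: "\<phi> (cell h) = cell (\<psi> h)" if "h \<in> labels" for h
    using that by (simp add: \<phi>_def inv_into_f_f[OF inj_on_cell])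
  show ?thesis
  proof (rule that)
    have "bij_betw \<phi> K K"
      unfolding \<phi>_def
      by (intro bij_betw_trans[OF bij_betw_trans[OF bij_betw_inv_into[OF cell_bij] \<psi>_bij] cell_bij])
    moreover have "\<phi> F \<subseteq> \<phi> G \<longleftrightarrow> F \<subseteq> G" if FG: "F \<in> K" "G \<in> K" for F G
    proof -
      obtain g h where "g \<in> labels" "F = cell g" "h \<in> labels" "G = cell h"
        using FG unfolding K_labels by auto
      then show ?thesis by (simp add: \<phi>_cell cell_subset_iff \<psi>_labels \<psi>_le)
    qed
    ultimately show "complex_automorphism K \<phi>" by (simp add: complex_automorphism_def)
    fix j N assume jN: "j \<in> J" "admissible N"
    have "lab j N \<in> labels" using jN by (auto simp: labels_def)
    from \<phi>_cell[OF this] show "\<phi> (lift j ` polygon_face N) =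
        lift (\<lambda>k. \<pi> k (j (\<sigma> k))) ` polygon_face {k. k < p \<and> \<sigma> k \<in> N}"
      unfolding \<psi>_lab cell_lab[OF jN] cell_lab[OF \<pi>(2)[OF jN(1)] \<sigma>(2)[OF jN(2)]] .
  qed
qed

text \<open>Every face inside the polygon of \<open>j\<close> can be written with the same vector
  \<open>j\<close>. So a flag amounts to a polygon, an edge \<open>i\<close> of it, and a
  neighbouring edge \<open>l\<close> that picks the vertex.\<close>

lemma flag_iff: "flag K x e P \<longleftrightarrow> (\<exists>j i l. j \<in> J \<and> adj i l \<and>
    x = lift j ` polygon_face {i, l} \<and> e = lift j ` polygon_face {i} \<and> P = lift j ` polygon_face {})"
proof
  assume F: "flag K x e P"
  then obtain j where j: "j \<in> J" "P = lift j ` C"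
    unfolding flag_def cells_2_eq by auto
  have empty: "admissible {}" by (simp add: admissible_def)
  have in_P: "\<exists>N. admissible N \<and> G = lift j ` polygon_face N \<and> aff_dim G = 2 - int (card N)"
    if G: "G \<in> K" "G \<subseteq> P" for G
  proof -
    obtain j' N where N: "j' \<in> J" "admissible N" "G = lift j' ` polygon_face N"
      using G(1) unfolding K_eq by auto
    have "lift j' ` polygon_face N \<subseteq> lift j ` polygon_face {}"
      using G(2) by (simp add: N j(2) polygon_face_simps)
    then have "\<forall>k<p. k \<notin> N \<longrightarrow> j' k = j k"
      unfolding face_subset_iff[OF N(1) j(1) N(2) empty] by simp
    then have "lift j' ` polygon_face N \<subseteq> lift j ` polygon_face N"
      "lift j ` polygon_face N \<subseteq> lift j' ` polygon_face N"
      unfolding face_subset_iff[OF N(1) j(1) N(2) N(2)] face_subset_iff[OF j(1) N(1) N(2) N(2)] by auto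
    then show ?thesis using N by (auto simp: aff_dim_lift aff_dim_polygon_face)
  qed
  obtain M where M: "admissible M" "x = lift j ` polygon_face M" "card M = 2"
    using in_P[of x] F by (force simp: flag_def cells_def)
  obtain N where N: "admissible N" "e = lift j ` polygon_face N" "card N = 1"
    using in_P[of e] F by (force simp: flag_def cells_def)
  obtain i where i: "N = {i}" using N(3) by (auto simp: card_1_singleton_iff)
  have "N \<subseteq> M"
    using F face_subset_iff[OF j(1) j(1) M(1) N(1)] by (auto simp: flag_def M N)
  then obtain l where l: "M = {i, l}"
    using M(3) unfolding i card_2_iff by auto
  have "adj i l"
    using M(1,3) unfolding l admissible_iff_adj adj_def by (auto simp: doubleton_eq_iff)
  then show "\<exists>j i l. j \<in> J \<and> adj i l \<and>
    x = lift j ` polygon_face {i, l} \<and> e = lift j ` polygon_face {i} \<and> P = lift j ` polygon_face {}"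
    using j M N i l by (intro exI[of _ j] exI[of _ i] exI[of _ l]) (simp add: polygon_face_simps)
next
  assume "\<exists>j i l. j \<in> J \<and> adj i l \<and>
    x = lift j ` polygon_face {i, l} \<and> e = lift j ` polygon_face {i} \<and> P = lift j ` polygon_face {}"
  then obtain j i l where j: "j \<in> J" and il: "adj i l" and eqs: "x = lift j ` polygon_face {i, l}"
    "e = lift j ` polygon_face {i}" "P = lift j ` polygon_face {}"
    by blast
  have adm: "admissible {}" "admissible {i}" "admissible {i, l}" and ne: "i \<noteq> l"
    using il unfolding admissible_iff_adj by (auto simp: adj_def)
  then show "flag K x e P"
    unfolding flag_def cells_def eqs K_eq mem_Collect_eq aff_dim_lift
      face_subset_iff[OF j j adm(3,2)] face_subset_iff[OF j j adm(2,1)]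
      aff_dim_polygon_face[OF adm(1)] aff_dim_polygon_face[OF adm(2)] aff_dim_polygon_face[OF adm(3)]
    using j by auto
qed

text \<open>The map \<open>\<sigma> k = i + d * (k - i')\<close> modulo \<open>p\<close> sends
  \<open>i'\<close> to \<open>i\<close>, and the sign \<open>d = e * e'\<close> makes it send
  \<open>l' = i' + e'\<close> to \<open>i + d * e' = i + e = l\<close>. Preimages appear because
  vectors are pulled back along \<sigma>.\<close>

lemma ex_dihedral:
  assumes "adj i l" "adj i' l'"
  obtains \<sigma> where "bij_betw \<sigma> {..<p} {..<p}" "\<And>N. admissible N \<Longrightarrow> admissible {k. k < p \<and> \<sigma> k \<in> N}"
    and "{k. k < p \<and> \<sigma> k \<in> {i}} = {i'}" "{k. k < p \<and> \<sigma> k \<in> {i, l}} = {i', l'}"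
proof -
  obtain e e' where e: "e \<in> {1, -1}" "[int l = int i + e] (mod int p)"
    "e' \<in> {1, -1}" "[int l' = int i' + e'] (mod int p)"
    using assms unfolding adj_int by blast
  have less: "i < p" "l < p" "i' < p" "l' < p" using assms by (auto simp: adj_def)
  define d where "d = e * e'"
  have d: "d \<in> {1, -1}" "d * e' = e" "d * d = 1" using e by (auto simp: d_def)
  define \<sigma> where "\<sigma> k = nat ((int i + d * (int k - int i')) mod int p)" for k
  have p0: "p > 0" using p3 by simp
  have \<sigma>: "\<sigma> k < p" "[int (\<sigma> k) = int i + d * (int k - int i')] (mod int p)" for k
    using p0 by (auto simp: \<sigma>_def nat_less_iff cong_def)
  have eqI: "m = n" if "[int m = int n] (mod int p)" "m < p" "n < p" for m n
    using that by (simp add: cong_int_iff cong_def)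
  have diff: "[int (\<sigma> m) - int (\<sigma> n) = d * (int m - int n)] (mod int p)" for m n
  proof -
    have "[int (\<sigma> m) - int (\<sigma> n) =
        (int i + d * (int m - int i')) - (int i + d * (int n - int i'))] (mod int p)"
      by (intro cong_diff \<sigma>(2))
    then show ?thesis by (simp add: algebra_simps)
  qed
  have diff': "[int m - int n = d * (int (\<sigma> m) - int (\<sigma> n))] (mod int p)" for m n
  proof -
    have "[d * (d * (int m - int n)) = d * (int (\<sigma> m) - int (\<sigma> n))] (mod int p)"
      by (intro cong_scalar_left cong_sym[OF diff])
    then show ?thesis using d(3) by (simp add: mult.assoc[symmetric])
  qed
  have inj: "inj_on \<sigma> {..<p}"
  proof (rule inj_onI)
    fix m n assume mn: "m \<in> {..<p}" "n \<in> {..<p}" "\<sigma> m = \<sigma> n"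
    then have "[int m - int n = 0] (mod int p)" using diff'[of m n] by simp
    then show "m = n" using mn eqI[of m n] by (simp add: cong_diff_iff_cong_0)
  qed
  have bij: "bij_betw \<sigma> {..<p} {..<p}"
    using endo_inj_surj[OF _ _ inj] inj \<sigma>(1) by (auto simp: bij_betw_def)
  have adj_\<sigma>: "adj m n" if "m < p" "n < p" "adj (\<sigma> m) (\<sigma> n)" for m n
  proof -
    obtain c where c: "c \<in> {1, -1}" "[int (\<sigma> n) = int (\<sigma> m) + c] (mod int p)"
      using \<open>adj (\<sigma> m) (\<sigma> n)\<close> unfolding adj_int by blast
    have "[int (\<sigma> n) - int (\<sigma> m) = c] (mod int p)"
      using c(2) by (simp add: cong_iff_dvd_diff algebra_simps)
    then have "[d * (int (\<sigma> n) - int (\<sigma> m)) = d * c] (mod int p)" by (rule cong_scalar_left)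
    with diff'[of n m] have "[int n - int m = d * c] (mod int p)" by (rule cong_trans)
    then have "[int n = int m + d * c] (mod int p)" by (simp add: cong_iff_dvd_diff algebra_simps)
    moreover have "d * c \<in> {1, -1}" using d(1) c(1) by auto
    ultimately show ?thesis using that unfolding adj_int by blast
  qed
  have surj: "\<exists>m<p. \<sigma> m = k" if "k < p" for k
    using bij that unfolding bij_betw_def by (metis imageE lessThan_iff)
  have pre: "{k. k < p \<and> \<sigma> k \<in> \<sigma> ` N} = N" if "N \<subseteq> {..<p}" for N
    using inj that by (auto simp: inj_on_def)
  show ?thesis
  proof (rule that[OF bij])
    have i: "\<sigma> i' = i" using \<sigma>[of i'] less by (intro eqI) auto
    have "[int i + d * (int l' - int i') = int i + d * e'] (mod int p)"
      using e(4) by (intro cong_add cong_scalar_left cong_refl) (simp add: cong_iff_dvd_diff algebra_simps)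
    then have "[int (\<sigma> l') = int l] (mod int p)"
      using \<sigma>(2)[of l'] e(2) unfolding d(2) by (metis cong_sym cong_trans)
    then have l: "\<sigma> l' = l" using \<sigma>(1) less by (intro eqI) auto
    show "{k. k < p \<and> \<sigma> k \<in> {i}} = {i'}" "{k. k < p \<and> \<sigma> k \<in> {i, l}} = {i', l'}"
      using pre[of "{i'}"] pre[of "{i', l'}"] less by (simp_all add: i l)
    fix N assume N: "admissible N"
    define M where "M = {k. k < p \<and> \<sigma> k \<in> N}"
    have NM: "N = \<sigma> ` M" using surj admissible_subset[OF N] by (fastforce simp: M_def)
    consider "N = {}" | n where "n < p" "N = {n}" | m n where "adj m n" "N = {m, n}"
      using N unfolding admissible_iff_adj by blast
    then have "admissible M"
    proof cases
      case 1
      then show ?thesis using NM by (simp add: admissible_def)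
    next
      case (2 n)
      then obtain k where k: "k < p" "\<sigma> k = n" using surj by blast
      then have "M = {k}" using pre[of "{k}"] unfolding M_def 2 by simp
      then show ?thesis using k by (auto simp: admissible_def)
    next
      case (3 m n)
      then obtain k k' where k: "k < p" "\<sigma> k = m" "k' < p" "\<sigma> k' = n" using surj unfolding adj_def by metis
      then have "M = {k, k'}" using pre[of "{k, k'}"] unfolding M_def 3 by simp
      moreover have "adj k k'" using adj_\<sigma> k 3(1) by blast
      ultimately show ?thesis unfolding admissible_iff_adj by blast
    qed
    then show "admissible {k. k < p \<and> \<sigma> k \<in> N}" by (simp add: M_def)
  qed
qed

text \<open>The digit maps are \<open>x |-> j' k + d * (x - j (\<sigma> k))\<close> modulo q, which
  turn the sum of \<open>g\<close> into \<open>s j' + d * (s g - s j)\<close>. If \<open>j\<close>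
  and \<open>j'\<close> have sums of the same residue, \<open>d = 1\<close> keeps the residue of
  \<open>g\<close>; otherwise \<open>s j + s j'\<close> is 1 modulo q, and \<open>d = -1\<close>
  gives \<open>1 - s g\<close>, exchanging the residues 0 and 1.\<close>

lemma ex_digit_permutation:
  assumes j: "j \<in> J" "j' \<in> J" and \<sigma>: "bij_betw \<sigma> {..<p} {..<p}"
  obtains \<pi> where "\<And>k. k < p \<Longrightarrow> inj_on (\<pi> k) {..<q}" "\<And>g. g \<in> J \<Longrightarrow> (\<lambda>k. \<pi> k (g (\<sigma> k))) \<in> J"
    and "\<And>k. k < p \<Longrightarrow> \<pi> k (j (\<sigma> k)) = j' k"
proof -
  define s where "s g = (\<Sum>k<p. int (g k))" for g :: "nat \<Rightarrow> nat"
  define d :: int where "d = (if [s j = s j'] (mod int q) then 1 else -1)"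
  define \<pi> where "\<pi> k x = nat ((int (j' k) + d * (int x - int (j (\<sigma> k)))) mod int q)" for k x
  have q0: "q > 0" using q2 by simp
  have d1: "d * d = 1" by (simp add: d_def)
  have \<pi>: "\<pi> k x < q" "[int (\<pi> k x) = int (j' k) + d * (int x - int (j (\<sigma> k)))] (mod int q)" for k x
    using q0 by (auto simp: \<pi>_def nat_less_iff cong_def)
  have eqI: "m = n" if "[int m = int n] (mod int q)" "m < q" "n < q" for m n
    using that by (simp add: cong_int_iff cong_def)
  have sJ: "[s g = 0] (mod int q) \<or> [s g = 1] (mod int q)" if "g \<in> J" for g
    using that by (simp add: J_def balanced_int s_def)
  show ?thesis
  proof (rule that)
    fix k show "inj_on (\<pi> k) {..<q}"
    proof (rule inj_onI)
      fix x y assume xy: "x \<in> {..<q}" "y \<in> {..<q}" "\<pi> k x = \<pi> k y"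
      have "[int (j' k) + d * (int x - int (j (\<sigma> k))) = int (j' k) + d * (int y - int (j (\<sigma> k)))] (mod int q)"
        using \<pi>(2)[of k x] \<pi>(2)[of k y] unfolding xy(3) by (metis cong_sym cong_trans)
      then have "[d * int x = d * int y] (mod int q)"
        by (simp add: cong_iff_dvd_diff algebra_simps)
      then have "[d * (d * int x) = d * (d * int y)] (mod int q)" by (rule cong_scalar_left)
      then have "[int x = int y] (mod int q)" by (simp add: mult.assoc[symmetric] d1)
      then show "x = y" using xy by (intro eqI) auto
    qed
    assume "k < p"
    then show "\<pi> k (j (\<sigma> k)) = j' k"
      using \<pi>[of k "j (\<sigma> k)"] J_less[OF j(2)] by (intro eqI) auto
  next
    fix g assume g: "g \<in> J"
    have re: "(\<Sum>k<p. int (f (\<sigma> k))) = s f" for f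
      unfolding s_def using sum.reindex_bij_betw[OF \<sigma>, of "\<lambda>k. int (f k)"] by simp
    have "[(\<Sum>k<p. int (\<pi> k (g (\<sigma> k)))) =
        (\<Sum>k<p. int (j' k) + d * (int (g (\<sigma> k)) - int (j (\<sigma> k))))] (mod int q)"
      by (intro cong_sum \<pi>(2))
    also have "(\<Sum>k<p. int (j' k) + d * (int (g (\<sigma> k)) - int (j (\<sigma> k)))) = s j' + d * (s g - s j)"
      by (simp add: sum.distrib sum_subtractf sum_distrib_left[symmetric] re) (simp add: s_def)
    finally have sum: "[(\<Sum>k<p. int (\<pi> k (g (\<sigma> k)))) = s j' + d * (s g - s j)] (mod int q)" .
    have "[s j' + d * (s g - s j) = 0] (mod int q) \<or> [s j' + d * (s g - s j) = 1] (mod int q)"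
    proof (cases "[s j = s j'] (mod int q)")
      case True
      have "[s j' + d * (s g - s j) = s g + (s j - s j)] (mod int q)"
        using True by (simp add: d_def cong_iff_dvd_diff algebra_simps dvd_diff_commute)
      then show ?thesis using sJ[OF g] by (metis cong_trans diff_self add.right_neutral)
    next
      case False
      then have "[s j' + s j = 1] (mod int q)"
        using sJ[OF j(1)] sJ[OF j(2)] cong_add[of "s j'" _ "int q" "s j"]
        by (metis add.left_neutral add.right_neutral cong_sym cong_trans)
      then have "[s j' + s j - s g = 1 - s g] (mod int q)" by (intro cong_diff cong_refl)
      moreover have "[1 - s g = 1] (mod int q) \<or> [1 - s g = 0] (mod int q)"
        using sJ[OF g] cong_diff[OF cong_refl[of 1 "int q"], of "s g"] by force
      ultimately show ?thesis
        using False by (simp add: d_def algebra_simps) (metis cong_trans)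
    qed
    then have "balanced (\<lambda>k. \<pi> k (g (\<sigma> k)))"
      unfolding balanced_int using sum by (metis cong_trans)
    then show "(\<lambda>k. \<pi> k (g (\<sigma> k))) \<in> J" using \<pi>(1) by (simp add: J_def)
  qed
qed

lemma regular_K: "regular_complex K"
  unfolding regular_complex_def
proof (intro allI impI, elim conjE)
  fix x e P x' e' P' assume F: "flag K x e P" and F': "flag K x' e' P'"
  obtain j i l where j: "j \<in> J" "adj i l" "x = lift j ` polygon_face {i, l}"
    "e = lift j ` polygon_face {i}" "P = lift j ` polygon_face {}"
    using F unfolding flag_iff by blast
  obtain j' i' l' where j': "j' \<in> J" "adj i' l'" "x' = lift j' ` polygon_face {i', l'}"
    "e' = lift j' ` polygon_face {i'}" "P' = lift j' ` polygon_face {}"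
    using F' unfolding flag_iff by blast
  obtain \<sigma> where \<sigma>: "bij_betw \<sigma> {..<p} {..<p}" "\<And>N. admissible N \<Longrightarrow> admissible {k. k < p \<and> \<sigma> k \<in> N}"
    and pre: "{k. k < p \<and> \<sigma> k \<in> {i}} = {i'}" "{k. k < p \<and> \<sigma> k \<in> {i, l}} = {i', l'}"
    by (rule ex_dihedral[OF j(2) j'(2)]) blast
  obtain \<pi> where \<pi>: "\<And>k. k < p \<Longrightarrow> inj_on (\<pi> k) {..<q}" "\<And>g. g \<in> J \<Longrightarrow> (\<lambda>k. \<pi> k (g (\<sigma> k))) \<in> J"
    and \<pi>_j: "\<And>k. k < p \<Longrightarrow> \<pi> k (j (\<sigma> k)) = j' k"
    by (rule ex_digit_permutation[OF j(1) j'(1) \<sigma>(1)]) blast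
  obtain \<phi> where \<phi>: "complex_automorphism K \<phi>" and \<phi>_face: "\<And>j N. j \<in> J \<Longrightarrow> admissible N \<Longrightarrow>
      \<phi> (lift j ` polygon_face N) = lift (\<lambda>k. \<pi> k (j (\<sigma> k))) ` polygon_face {k. k < p \<and> \<sigma> k \<in> N}"
    by (rule relabelling_automorphism[OF \<sigma> \<pi>]) blast+
  have lift_eq: "lift (\<lambda>k. \<pi> k (j (\<sigma> k))) = lift j'"
    using \<pi>_j by (auto simp: fun_eq_iff lift_def vec_eq_iff)
  have "admissible {}" "admissible {i}" "admissible {i, l}"
    using j(2) unfolding admissible_iff_adj by (auto simp: adj_def)
  then have "\<phi> x = x'" "\<phi> e = e'" "\<phi> P = P'"
    using \<phi>_face[OF j(1), unfolded lift_eq] pre unfolding j(3-5) j'(3-5) by auto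
  with \<phi> show "\<exists>\<phi>. complex_automorphism K \<phi> \<and> \<phi> x = x' \<and> \<phi> e = e' \<and> \<phi> P = P'" by blast
qed

end


text \<open>Here \<open>k\<close> is minus the Euler characteristic and has to be even and at least
  -2. For even q the power of q is even because p is at least 3; for odd q the factor
  \<open>q - 1\<close> makes the bracket even.\<close>

lemma genus_exists:
  fixes p q :: nat
  assumes "p \<ge> 3" "q \<ge> 2"
  obtains g :: nat
  where "2 - 2 * int g = int q ^ (p - 2) * (int p - int p * int q + 2 * int q)"
proof -
  define k where "k = int q ^ (p - 2) * ((int p - 2) * (int q - 1) - 2)"
  have k: "int q ^ (p - 2) * (int p - int p * int q + 2 * int q) = - k"
    by (simp add: k_def algebra_simps)
  have "even k"
  proof (cases "even q")
    case True
    then show ?thesis using assms by (simp add: k_def)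
  next
    case False
    then show ?thesis using assms by (simp add: k_def)
  qed
  moreover have "- 2 \<le> k"
  \<comment> \<open>The only case with \<open>(p - 2) * (q - 1)\<close> below 2. Its f-vector (6,
    12, 8) is that of the octahedron, so the genus is 0.\<close>
  proof (cases "p = 3 \<and> q = 2")
    case True
    then show ?thesis by (simp add: k_def)
  next
    case False
    then consider "int p - 2 \<ge> 2" | "int q - 1 \<ge> 2" using assms by linarith
    then have "2 \<le> (int p - 2) * (int q - 1)"
    proof cases
      case 1
      then show ?thesis using assms mult_mono[of 2 "int p - 2" 1 "int q - 1"] by simp
    next
      case 2
      then show ?thesis using assms mult_mono[of 1 "int p - 2" 2 "int q - 1"] by simp
    qed
    then have "0 \<le> k" by (simp add: k_def)
    then show ?thesis by simp
  qed
  ultimately have "2 - 2 * int (nat ((k + 2) div 2)) = - k" by auto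
  then show ?thesis using k that by metis
qed

theorem theorem3p7:
  fixes p q :: nat
    and a :: "nat \<Rightarrow> real^2"
    and b :: "nat \<Rightarrow> real^'r"
    and \<iota> :: "nat \<Rightarrow> 'p::finite"
  assumes "p \<ge> 3" and "q \<ge> 2"
    and "CARD('p) = p" and "CARD('r) = q - 1"
    and "bij_betw \<iota> {..<p} UNIV"
    and "polygon_presentation p a"
    and "simplex_presentation q b"
  shows
    "closed_2_manifold (\<Union>(Sigma_complex p q a b \<iota>)) \<and>
     connected (\<Union>(Sigma_complex p q a b \<iota>)) \<and>
     orientable (Sigma_complex p q a b \<iota>) \<and>
     regular_complex (Sigma_complex p q a b \<iota>) \<and>
     has_type (Sigma_complex p q a b \<iota>) p (2 * q) \<and>
     f_number 0 (Sigma_complex p q a b \<iota>) = p * q ^ (p - 2) \<and>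
     f_number 1 (Sigma_complex p q a b \<iota>) = p * q * q ^ (p - 2) \<and>
     f_number 2 (Sigma_complex p q a b \<iota>) = 2 * q * q ^ (p - 2) \<and>
     (\<exists>g. has_genus (Sigma_complex p q a b \<iota>) g \<and>
            real g = 1 + 1 / 2 * real q ^ (p - 2) * (real p * real q - real p - 2 * real q))"
proof -
  have q1: "1 \<le> q" and dim: "DIM(real^'r) = q - 1" using assms(2,4) by auto
  obtain w where w: "\<And>j k. j < q \<Longrightarrow> k < q \<Longrightarrow> k \<noteq> j \<Longrightarrow> b k \<bullet> w j = 1"
    "\<And>j. j < q \<Longrightarrow> b j \<bullet> w j < 1"
    "\<And>j d. j < q \<Longrightarrow> (\<And>k. k < q \<Longrightarrow> k \<noteq> j \<Longrightarrow> b k \<bullet> d = 0) \<Longrightarrow> d = 0"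
    by (rule simplex_presentation_vertices[OF q1 dim assms(7)]) blast
  interpret wedge_surface p a q b w \<iota>
    by unfold_locales (use assms w in blast)+
  have pow: "q ^ (p - 1) = q * q ^ (p - 2)"
  proof -
    have "p - 1 = Suc (p - 2)" using assms(1) by simp
    then show ?thesis by simp
  qed
  have f0: "f_number 0 K = p * q ^ (p - 2)" by (rule f_number_0)
  have f1: "f_number 1 K = p * q * q ^ (p - 2)" by (simp only: f_number_1 pow mult.assoc)
  have f2: "f_number 2 K = 2 * q * q ^ (p - 2)" by (simp only: f_number_2 pow mult.assoc)
  obtain g :: nat
    where g: "2 - 2 * int g = int q ^ (p - 2) * (int p - int p * int q + 2 * int q)"
    by (rule genus_exists[OF assms(1,2)])
  have "euler_characteristic K = 2 - 2 * int g"
    unfolding euler_characteristic_def f0 f1 f2 g by (simp add: algebra_simps)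
  then have "has_genus K g"
    using closed_2_manifold_K connected_Union_K orientable_K by (simp add: has_genus_def)
  moreover have "2 - 2 * real g = real q ^ (p - 2) * (real p - real p * real q + 2 * real q)"
    using arg_cong[OF g, of real_of_int] by simp
  then have "real g = 1 + 1 / 2 * real q ^ (p - 2) * (real p * real q - real p - 2 * real q)"
    by (simp add: field_simps)
  ultimately show ?thesis
    using closed_2_manifold_K connected_Union_K orientable_K regular_K has_type_K f0 f1 f2 by blast
qed

end
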